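(* Let $q\ge5$ be a power of $3$. Then $\Lambda_{\mathrm{EA},2_{\mathcal C}}=q-1$, $\Pi_{2_{\mathcal C},\mathrm{EA}}=\frac{q}{q+1}$, $\Lambda_{\mathrm{En}\Gamma,2_{\mathcal C}}=(q-1)^2$, and $\Pi_{2_{\mathcal C},\mathrm{En}\Gamma}=1$.
   Context: Let $\mathrm{PG}(3,q)$ have points $\mathbf{P}(x_0,x_1,x_2,x_3)$; put $P(t)=\mathbf{P}(t^3,t^2,t,1)$ ($t\in\mathbb{F}_q$), $P(\infty)=\mathbf{P}(1,0,0,0)$, $\mathcal{C}=\{P(t):t\in\mathbb{F}_q\cup\{\infty\}\}$ the twisted cubic, $G_q$ the group of projectivities fixing $\mathcal C$. Write $\boldsymbol{\pi}(c_0,c_1,c_2,c_3)$ for the plane $c_0x_0+c_1x_1+c_2x_2+c_3x_3=0$. $\Gamma$-planes: the osculating planes $\boldsymbol{\pi}(1,-3t,3t^2,-t^3)$ ($t\in\mathbb{F}_q$) and $\boldsymbol{\pi}(0,0,0,1)$; for $q\equiv 0\pmod 3$ they all contain a common line, the axis $\mathrm{A}$. A $2_{\mathcal C}$-plane contains exactly $2$ points of $\mathcal C$ (these form a $G_q$-orbit for $q\ge5$). An EA-line is a line with no point of $\mathcal C$, different from $\mathrm{A}$, meeting $\mathrm{A}$. An imaginary chord is the line joining $P(s),P(s^q)$, $s\in\mathbb{F}_{q^2}\setminus\mathbb{F}_q$. An En$\Gamma$-line is a line with no point of $\mathcal C$, lying in no $\Gamma$-plane, which is not an imaginary chord. Notation: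 $\Lambda_{\lambda,\pi}$ is the number of $\lambda$-lines in a $\pi$-plane; $\Pi_{\pi,\lambda}$ is the average, over all $\lambda$-lines, of the number of $\pi$-planes through the line. *)

theory Defs
  imports "HOL-Analysis.Analysis" "HOL-Algebra.Algebraic_Closure_Type"
begin

text \<open>
  Points, lines and planes of PG(3,F) are the linear subspaces of \<open>F\<^sup>4\<close> of dimension 1, 2 and 3;
  incidence is inclusion. The homogeneous coordinates \<open>x\<^sub>0, x\<^sub>1, x\<^sub>2, x\<^sub>3\<close> are the components
  \<open>x $ 1, x $ 2, x $ 3, x $ 4\<close>.
\<close>

definition pg_point :: "('a::field ^ 4) set \<Rightarrow> bool" where
  "pg_point p \<longleftrightarrow> vec.subspace p \<and> vec.dim p = 1"

definition pg_line :: "('a::field ^ 4) set \<Rightarrow> bool" where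
  "pg_line l \<longleftrightarrow> vec.subspace l \<and> vec.dim l = 2"

definition pg_plane :: "('a::field ^ 4) set \<Rightarrow> bool" where
  "pg_plane \<pi> \<longleftrightarrow> vec.subspace \<pi> \<and> vec.dim \<pi> = 3"

definition plane_of :: "'a::field \<Rightarrow> 'a \<Rightarrow> 'a \<Rightarrow> 'a \<Rightarrow> ('a ^ 4) set" where
  "plane_of c\<^sub>0 c\<^sub>1 c\<^sub>2 c\<^sub>3 = {x. c\<^sub>0 * x $ 1 + c\<^sub>1 * x $ 2 + c\<^sub>2 * x $ 3 + c\<^sub>3 * x $ 4 = 0}"

definition cubic_vec :: "'a::field \<Rightarrow> 'a ^ 4" where
  "cubic_vec t = vector [t ^ 3, t ^ 2, t, 1]"

definition cubic_vec_inf :: "'a::field ^ 4" where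
  "cubic_vec_inf = vector [1, 0, 0, 0]"

definition twisted_cubic :: "('a::field ^ 4) set set" where
  "twisted_cubic = insert (vec.span {cubic_vec_inf}) (range (\<lambda>t. vec.span {cubic_vec t}))"

definition Gamma_planes :: "('a::field ^ 4) set set" where
  "Gamma_planes = insert (plane_of 0 0 0 1)
     (range (\<lambda>t. plane_of 1 (- 3 * t) (3 * t ^ 2) (- (t ^ 3))))"

text \<open>Only meaningful in characteristic 3, where the \<open>\<Gamma>\<close>-planes intersect in a line.\<close>

definition axis :: "('a::field ^ 4) set" where
  "axis = \<Inter> Gamma_planes"

definition two_C_planes :: "('a::field ^ 4) set set" where
  "two_C_planes = {\<pi>. pg_plane \<pi> \<and> card {P \<in> twisted_cubic. P \<subseteq> \<pi>} = 2}"

definition external_line :: "('a::field ^ 4) set \<Rightarrow> bool" where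
  "external_line l \<longleftrightarrow> pg_line l \<and> (\<forall>P \<in> twisted_cubic. \<not> P \<subseteq> l)"

definition EA_lines :: "('a::field ^ 4) set set" where
  "EA_lines = {l. external_line l \<and> l \<noteq> axis \<and> (\<exists>P. pg_point P \<and> P \<subseteq> l \<and> P \<subseteq> axis)}"

text \<open>
  \<open>F\<^bsub>q\<^sup>2\<^esub>\<close> is realised inside the algebraic closure of \<open>F\<^sub>q\<close>, into which \<open>F\<^sub>q\<close> is embedded by \<open>to_ac\<close>.
\<close>

definition quadratic_extension :: "'a::{field,finite} alg_closure set" where
  "quadratic_extension = {s. s ^ (CARD('a) ^ 2) = s}"

definition extend_vec :: "'a::field ^ 4 \<Rightarrow> 'a alg_closure ^ 4" where
  "extend_vec x = (\<chi> i. to_ac (x $ i))"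

text \<open>
  The line joining the conjugate points \<open>P(s)\<close> and \<open>P(s\<^sup>q)\<close> is a line over the extension field;
  as a line of PG(3,q) it is the line whose extension of scalars is that line.
\<close>

definition imaginary_chord :: "('a::{field,finite} ^ 4) set \<Rightarrow> bool" where
  "imaginary_chord l \<longleftrightarrow> pg_line l \<and>
     (\<exists>s \<in> quadratic_extension - range to_ac.
        vec.span (extend_vec ` l) = vec.span {cubic_vec s, cubic_vec (s ^ CARD('a))})"

definition EnGamma_lines :: "('a::{field,finite} ^ 4) set set" where
  "EnGamma_lines = {l. external_line l \<and> (\<forall>\<pi> \<in> Gamma_planes. \<not> l \<subseteq> \<pi>) \<and> \<not> imaginary_chord l}"

definition num_lines_in :: "('a::field ^ 4) set set \<Rightarrow> ('a ^ 4) set \<Rightarrow> nat" where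
  "num_lines_in L \<pi> = card {l \<in> L. l \<subseteq> \<pi>}"

definition avg_planes_through :: "('a::field ^ 4) set set \<Rightarrow> ('a ^ 4) set set \<Rightarrow> real" where
  "avg_planes_through Pl L = (\<Sum>l\<in>L. real (card {\<pi> \<in> Pl. l \<subseteq> \<pi>})) / real (card L)"

end

theory Submission
  imports Defs "HOL-Number_Theory.Residues"
begin

text \<open>
  In characteristic 3 the axis is \<open>x\<^sub>0 = x\<^sub>3 = 0\<close> and the \<open>\<Gamma>\<close>-planes are all planes through it, so a line lies in
  no \<open>\<Gamma>\<close>-plane iff it is skew to the axis. A plane meeting the cubic in exactly two points corresponds to
  a binary cubic with a double root \<open>p\<close> and a simple root \<open>m\<close>; it meets the axis in one point \<open>A\<close>, and
  \<open>A, P(p), P(m)\<close> are independent. Its EA-lines are the lines through \<open>A\<close> avoiding the two cubic points;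
  its \<open>En\<Gamma>\<close>-lines are those avoiding all three points, because an imaginary chord in the plane would force
  an irreducible quadratic factor. The averages follow by double counting from the number of such planes,
  \<open>q (q + 1)\<close>, of EA-lines, \<open>(q + 1)\<^sup>2 (q - 1)\<close>, and of \<open>En\<Gamma>\<close>-lines, \<open>q (q + 1) (q - 1)\<^sup>2\<close>: of the \<open>q\<^sup>4\<close> lines
  skew to the axis, inclusion--exclusion removes those through cubic points, and the imaginary chords
  correspond to the \<open>(q\<^sup>2 - q) / 2\<close> irreducible monic quadratics.
\<close>

text \<open>Apart from identities that hold modulo 3, the characteristic enters through one fact:
  cubing is an additive bijection of the field. The outer coordinates of \<open>nu z\<close> are the
  cubes of the coordinates of \<open>z\<close>, so projection from the axis maps the cubic
  bijectively onto a projective line. Independence of an axis point from two cubic points, the shape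
  of the \<Gamma>-planes and the normal forms of lines thus reduce to nonvanishing 2 by 2
  determinants. The averages cannot be read off a single line: \<open>q / (q + 1)\<close> is no
  integer, so the number of planes varies from one EA-line to another. Hence each class of lines is
  counted as a whole, through an explicit parametrisation. Imaginary chords are the only objects
  defined over an extension field; describing each by the sum and product of its two conjugate
  parameters brings them back to the ground field.\<close>

no_notation fps_nth (infixl \<open>$\<close> 75)

section \<open>Subspaces spanned by two or three vectors\<close>

text \<open>Stated for vectors rather than for the set \<open>{u, v}\<close>: the set collapses when
  \<open>u = v\<close>, and coefficients are compared directly later on.\<close>

definition lin_indep2 :: "'a::field ^ 'n \<Rightarrow> 'a ^ 'n \<Rightarrow> bool" where
  "lin_indep2 u v \<longleftrightarrow> (\<forall>a b. a *s u + b *s v = 0 \<longrightarrow> a = 0 \<and> b = 0)"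

definition lin_indep3 :: "'a::field ^ 'n \<Rightarrow> 'a ^ 'n \<Rightarrow> 'a ^ 'n \<Rightarrow> bool" where
  "lin_indep3 u v w \<longleftrightarrow> (\<forall>a b c. a *s u + b *s v + c *s w = 0 \<longrightarrow> a = 0 \<and> b = 0 \<and> c = 0)"

lemma vec_neg_eq_scale: "x + a *s u = 0 \<longleftrightarrow> x = (- a) *s (u :: 'a::field ^ 'n)"
  by (metis add_eq_0_iff2 vector_smult_lneg)

lemma mem_span2: "x \<in> vec.span {u, v} \<longleftrightarrow> (\<exists>a b. x = a *s u + b *s v)"
proof
  assume "x \<in> vec.span {u, v}"
  then obtain k where "x - k *s u \<in> vec.span {v}"
    by (auto simp: vec.span_insert)
  then obtain b where "x - k *s u = b *s v"
    by (auto simp: vec.span_singleton)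
  then have "x = k *s u + b *s v" by (simp add: algebra_simps)
  then show "\<exists>a b. x = a *s u + b *s v" by blast
next
  assume "\<exists>a b. x = a *s u + b *s v"
  then show "x \<in> vec.span {u, v}"
    by (auto simp: vec.span_add vec.span_scale vec.span_base)
qed

lemma mem_span3: "x \<in> vec.span {u, v, w} \<longleftrightarrow> (\<exists>a b c. x = a *s u + b *s v + c *s w)"
proof
  assume "x \<in> vec.span {u, v, w}"
  then obtain k where "x - k *s u \<in> vec.span {v, w}"
    by (auto simp: vec.span_insert[of u])
  then obtain b c where "x - k *s u = b *s v + c *s w"
    by (auto simp: mem_span2)
  then have "x = k *s u + b *s v + c *s w" by (simp add: algebra_simps)
  then show "\<exists>a b c. x = a *s u + b *s v + c *s w" by blast
next
  assume "\<exists>a b c. x = a *s u + b *s v + c *s w"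
  then show "x \<in> vec.span {u, v, w}"
    by (auto simp: vec.span_add vec.span_scale vec.span_base)
qed

lemma lin_indep2_iff: "lin_indep2 u v \<longleftrightarrow> vec.independent {u, v} \<and> u \<noteq> v"
proof
  assume i: "lin_indep2 u v"
  have "u \<noteq> v"
  proof
    assume "u = v"
    then have "1 *s u + (- 1) *s v = 0" by simp
    with i show False unfolding lin_indep2_def by (metis zero_neq_one)
  qed
  moreover have "v \<noteq> 0"
  proof
    assume "v = 0"
    then have "0 *s u + 1 *s v = 0" by simp
    with i show False unfolding lin_indep2_def by (metis zero_neq_one)
  qed
  moreover have "u \<notin> vec.span {v}"
  proof
    assume "u \<in> vec.span {v}"
    then obtain k where "u = k *s v" by (auto simp: vec.span_singleton)
    then have "1 *s u + (- k) *s v = 0" by simp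
    with i show False unfolding lin_indep2_def by (metis zero_neq_one)
  qed
  ultimately show "vec.independent {u, v} \<and> u \<noteq> v"
    by (simp add: vec.independent_insert)
next
  assume i: "vec.independent {u, v} \<and> u \<noteq> v"
  then have u: "u \<notin> vec.span {v}" and v: "v \<noteq> 0"
    by (auto simp: vec.independent_insert split: if_splits)
  show "lin_indep2 u v"
    unfolding lin_indep2_def
  proof (intro allI impI)
    fix a b assume e: "a *s u + b *s v = 0"
    have "a = 0"
    proof (rule ccontr)
      assume a: "a \<noteq> 0"
      have "a *s u = (- b) *s v" using e by (simp add: vec_neg_eq_scale)
      then have "(1 / a) *s (a *s u) = (1 / a) *s ((- b) *s v)" by simp
      then have "u = (- b / a) *s v" using a by simp
      then show False using u by (metis vec.span_base vec.span_scale singletonI)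
    qed
    then show "a = 0 \<and> b = 0" using e v by simp
  qed
qed

lemma lin_indep3_iff: "lin_indep3 u v w \<longleftrightarrow> lin_indep2 v w \<and> u \<notin> vec.span {v, w}"
proof
  assume i: "lin_indep3 u v w"
  have "lin_indep2 v w" unfolding lin_indep2_def
  proof (intro allI impI)
    fix a b assume "a *s v + b *s w = 0"
    then have "0 *s u + a *s v + b *s w = 0" by simp
    with i show "a = 0 \<and> b = 0" unfolding lin_indep3_def by blast
  qed
  moreover have "u \<notin> vec.span {v, w}"
  proof
    assume "u \<in> vec.span {v, w}"
    then obtain a b where "u = a *s v + b *s w" by (auto simp: mem_span2)
    then have "1 *s u + (- a) *s v + (- b) *s w = 0" by simp
    with i show False unfolding lin_indep3_def by (metis zero_neq_one)
  qed
  ultimately show "lin_indep2 v w \<and> u \<notin> vec.span {v, w}" by blast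
next
  assume i: "lin_indep2 v w \<and> u \<notin> vec.span {v, w}"
  show "lin_indep3 u v w"
    unfolding lin_indep3_def
  proof (intro allI impI)
    fix a b c assume e: "a *s u + b *s v + c *s w = 0"
    have a: "a = 0"
    proof (rule ccontr)
      assume a: "a \<noteq> 0"
      have "a *s u = (- b) *s v + (- c) *s w" using e
        by (simp add: add_eq_0_iff2 algebra_simps)
      then have "(1 / a) *s (a *s u) = (1 / a) *s ((- b) *s v + (- c) *s w)" by simp
      then have "u = (- b / a) *s v + (- c / a) *s w" using a
        by (simp add: vec.scale_right_distrib vec.scale_right_diff_distrib)
      then have "u \<in> vec.span {v, w}" unfolding mem_span2 by blast
      then show False using i by simp
    qed
    then show "a = 0 \<and> b = 0 \<and> c = 0" using e i by (simp add: lin_indep2_def)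
  qed
qed

lemma lin_indep3_independent:
  assumes "lin_indep3 u v w"
  shows "vec.independent {u, v, w}" and "card {u, v, w} = 3"
proof -
  have i: "vec.independent {v, w}" "v \<noteq> w" "u \<notin> vec.span {v, w}"
    using assms by (auto simp: lin_indep3_iff lin_indep2_iff)
  then show "vec.independent {u, v, w}"
    by (simp add: vec.independent_insert[of u])
  have "u \<notin> {v, w}" using i(3) vec.span_base by blast
  then show "card {u, v, w} = 3" using i(2) by simp
qed

lemma pg_line_span:
  assumes "lin_indep2 u v"
  shows "pg_line (vec.span {u, v})"
  using assms by (simp add: pg_line_def lin_indep2_iff vec.dim_eq_card_independent)

lemma pg_line_subset_eq:
  assumes "pg_line l" "pg_line m" "l \<subseteq> m"
  shows "l = m"
  using assms vec.subspace_dim_equal[of l m] by (simp add: pg_line_def)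

lemma pg_line_eq_span:
  assumes "pg_line l" "u \<in> l" "v \<in> l" "lin_indep2 u v"
  shows "l = vec.span {u, v}"
proof -
  have "vec.span {u, v} \<subseteq> l"
    using assms by (intro vec.span_minimal) (auto simp: pg_line_def)
  then show ?thesis using pg_line_subset_eq[OF pg_line_span[OF assms(4)] assms(1)] by simp
qed

lemma pg_line_basis:
  assumes "pg_line l"
  obtains u v where "lin_indep2 u v" "l = vec.span {u, v}"
proof -
  obtain B where B: "B \<subseteq> l" "vec.independent B" "card B = vec.dim l"
    using vec.basis_exists by metis
  then obtain u v where uv: "B = {u, v}" "u \<noteq> v"
    using assms by (auto simp: pg_line_def card_2_iff)
  then have "lin_indep2 u v" using B by (simp add: lin_indep2_iff)
  then show ?thesis using that pg_line_eq_span[OF assms] B(1) uv by auto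
qed

lemma pg_line_basis_extend:
  assumes "pg_line l" "u \<in> l" "u \<noteq> 0"
  obtains v where "lin_indep2 u v" "l = vec.span {u, v}"
proof -
  have "\<not> l \<subseteq> vec.span {u}"
  proof
    assume "l \<subseteq> vec.span {u}"
    then have "vec.dim l \<le> vec.dim {u}" by (rule vec.dim_mono)
    then show False using assms by (simp add: pg_line_def)
  qed
  then obtain v where v: "v \<in> l" "v \<notin> vec.span {u}" by blast
  have "v \<noteq> u" using v(2) vec.span_base[of u "{u}"] by auto
  then have "lin_indep2 v u" using v assms(3)
    by (simp add: lin_indep2_iff vec.independent_insert)
  then have i: "lin_indep2 u v" by (auto simp: lin_indep2_iff insert_commute)
  show ?thesis using that[OF i pg_line_eq_span[OF assms(1,2) v(1) i]] .
qed

lemma pg_plane_eq_span: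
  assumes "pg_plane E" "u \<in> E" "v \<in> E" "w \<in> E" "lin_indep3 u v w"
  shows "E = vec.span {u, v, w}"
proof -
  have "vec.span {u, v, w} \<subseteq> E"
    using assms by (intro vec.span_minimal) (auto simp: pg_plane_def)
  moreover have "vec.dim (vec.span {u, v, w}) = 3"
    using lin_indep3_independent[OF assms(5)] by (simp add: vec.dim_eq_card_independent)
  ultimately show ?thesis
    using vec.subspace_dim_equal[of "vec.span {u, v, w}" E] assms(1)
    by (simp add: pg_plane_def)
qed

lemma subspace_comb2:
  assumes "vec.subspace S" "u \<in> S" "v \<in> S"
  shows "a *s u + b *s v \<in> S"
  using assms by (intro vec.subspace_add vec.subspace_scale) auto

lemma pg_line_comb: "pg_line l \<Longrightarrow> u \<in> l \<Longrightarrow> v \<in> l \<Longrightarrow> a *s u + b *s v \<in> l"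
  by (rule subspace_comb2) (auto simp: pg_line_def)

section \<open>Coordinates in dimension four and planes as kernels of linear forms\<close>

lemma vector_4 [simp]:
  "(vector [a, b, c, d] :: 'a::zero ^ 4) $ 1 = a"
  "(vector [a, b, c, d] :: 'a::zero ^ 4) $ 2 = b"
  "(vector [a, b, c, d] :: 'a::zero ^ 4) $ 3 = c"
  "(vector [a, b, c, d] :: 'a::zero ^ 4) $ 4 = d"
  unfolding vector_def by simp_all

lemma vec4_eq_iff: "x = (y :: 'a ^ 4) \<longleftrightarrow> x $ 1 = y $ 1 \<and> x $ 2 = y $ 2 \<and> x $ 3 = y $ 3 \<and> x $ 4 = y $ 4"
  by (simp add: vec_eq_iff forall_4)

lemma subspace_plane_of: "vec.subspace (plane_of a b c d)"
proof (rule vec.subspaceI)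
  let ?f = "\<lambda>x. a * x $ 1 + b * x $ 2 + c * x $ 3 + d * x $ 4"
  show "0 \<in> plane_of a b c d" by (simp add: plane_of_def)
  show "x + y \<in> plane_of a b c d" if "x \<in> plane_of a b c d" "y \<in> plane_of a b c d" for x y
  proof -
    have "?f (x + y) = ?f x + ?f y" by (simp add: algebra_simps)
    with that show ?thesis by (simp add: plane_of_def)
  qed
  show "k *s x \<in> plane_of a b c d" if "x \<in> plane_of a b c d" for k x
  proof -
    have "?f (k *s x) = k * ?f x" by (simp add: algebra_simps)
    with that show ?thesis by (simp add: plane_of_def)
  qed
qed

text \<open>The vector \<open>w\<close> certifies that the linear form is not zero. Subtracting a
  multiple of \<open>w\<close> moves any vector into the kernel, so the kernel and \<open>w\<close>
  span the space and the kernel has dimension 4 - 1.\<close>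

lemma pg_plane_plane_of:
  assumes "w \<notin> plane_of a b c d"
  shows "pg_plane (plane_of a b c d)"
proof -
  let ?E = "plane_of a b c d"
  let ?f = "\<lambda>x :: 'a ^ 4. a * x $ 1 + b * x $ 2 + c * x $ 3 + d * x $ 4"
  have sp: "vec.span ?E = ?E" using subspace_plane_of vec.span_eq_iff by blast
  have w: "?f w \<noteq> 0" using assms by (simp add: plane_of_def)
  have "x \<in> vec.span (insert w ?E)" for x
  proof -
    have "?f (x - k *s w) = ?f x - k * ?f w" for k
      by (simp add: algebra_simps)
    then have "?f (x - (?f x / ?f w) *s w) = ?f x - (?f x / ?f w) * ?f w" .
    also have "\<dots> = 0" using w by simp
    finally have "x - (?f x / ?f w) *s w \<in> ?E" by (simp add: plane_of_def)
    then show ?thesis unfolding vec.span_insert sp by blast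
  qed
  then have "vec.dim (vec.span (insert w ?E)) = vec.dim (UNIV :: ('a ^ 4) set)"
    by (metis UNIV_eq_I)
  then have "vec.dim (insert w ?E) = 4" by (simp only: vec.dim_span vec_dim_card) simp
  then have "vec.dim ?E = 3" using assms by (simp add: vec.dim_insert sp split: if_splits)
  then show ?thesis by (simp add: pg_plane_def subspace_plane_of)
qed

section \<open>The projective line and the twisted cubic\<close>

text \<open>One normalised representative per point, so that points are compared by equality and
  counted without quotients.\<close>

definition proj_line :: "('a::field \<times> 'a) set" where
  "proj_line = insert (1, 0) (range (\<lambda>t. (t, 1)))"

definition cross :: "'a::field \<times> 'a \<Rightarrow> 'a \<times> 'a \<Rightarrow> 'a" where
  "cross z w = fst z * snd w - snd z * fst w"

text \<open>The homogeneous form of \<open>cubic_vec\<close>, which puts the point at infinity on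
  the same footing as the others.\<close>

definition nu :: "'a::field \<times> 'a \<Rightarrow> 'a ^ 4" where
  "nu z = vector [fst z ^ 3, fst z ^ 2 * snd z, fst z * snd z ^ 2, snd z ^ 3]"

text \<open>The sign is chosen so that, for distinct \<open>p\<close> and \<open>m\<close>,
  incidence with \<open>cubic_plane p p m\<close> becomes the vanishing of
  \<open>cross p r\<close>.\<close>

definition axis_vec :: "'a::field \<times> 'a \<Rightarrow> 'a ^ 4" where
  "axis_vec r = vector [0, fst r, - snd r, 0]"

text \<open>The coefficients are those of the binary cubic \<open>z \<mapsto> cross z p * cross z m * cross z n\<close>. In characteristic 3
  the plane \<open>cubic_plane p p m\<close> meets the axis in the point \<open>axis_vec p\<close>.\<close>

definition cubic_plane :: "'a::field \<times> 'a \<Rightarrow> 'a \<times> 'a \<Rightarrow> 'a \<times> 'a \<Rightarrow> ('a ^ 4) set" where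
  "cubic_plane p m n = plane_of (snd p * snd m * snd n)
     (- (fst p * snd m * snd n + snd p * fst m * snd n + snd p * snd m * fst n))
     (fst p * fst m * snd n + fst p * snd m * fst n + snd p * fst m * fst n)
     (- (fst p * fst m * fst n))"

lemma cross_eq_0_iff: "z \<in> proj_line \<Longrightarrow> w \<in> proj_line \<Longrightarrow> cross z w = 0 \<longleftrightarrow> z = w"
  by (auto simp: proj_line_def cross_def)

lemma proj_line_representative:
  assumes "z \<noteq> (0, 0)"
  obtains w c where "w \<in> proj_line" "c \<noteq> 0" "z = (c * fst w, c * snd w)"
proof (cases "snd z = 0")
  case True
  then show ?thesis using that[of "(1, 0)" "fst z"] assms
    by (cases z) (auto simp: proj_line_def)
next
  case False
  then show ?thesis using that[of "(fst z / snd z, 1)" "snd z"]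
    by (cases z) (auto simp: proj_line_def)
qed

lemma card_proj_line: "card (proj_line :: ('a::{field,finite} \<times> 'a) set) = CARD('a) + 1"
proof -
  have "card (range (\<lambda>t::'a. (t, 1::'a))) = CARD('a)"
    by (rule card_image) (auto simp: inj_on_def)
  then show ?thesis unfolding proj_line_def by (subst card_insert_disjoint) auto
qed

lemma twisted_cubic_eq:
  "(twisted_cubic :: ('a::field ^ 4) set set) = (\<lambda>z. vec.span {nu z}) ` proj_line"
proof -
  have "nu (1, 0) = (cubic_vec_inf :: 'a ^ 4)" by (simp add: nu_def cubic_vec_inf_def)
  moreover have "nu (t, 1) = cubic_vec t" for t :: 'a by (simp add: nu_def cubic_vec_def)
  ultimately show ?thesis
    unfolding twisted_cubic_def proj_line_def by (simp add: image_image)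
qed

lemma inj_on_span_nu: "inj_on (\<lambda>z. vec.span {nu z}) proj_line"
proof (rule inj_onI)
  fix z w :: "'a \<times> 'a"
  assume z: "z \<in> proj_line" and w: "w \<in> proj_line" and e: "vec.span {nu z} = vec.span {nu w}"
  have "nu z \<in> vec.span {nu w}" unfolding e[symmetric] by (simp add: vec.span_base)
  then obtain k where "nu z = k *s nu w" by (auto simp: vec.span_singleton)
  then show "z = w" using z w
    by (auto simp: proj_line_def nu_def vec4_eq_iff)
qed

lemma span_singleton_subset: "vec.subspace S \<Longrightarrow> vec.span {x} \<subseteq> S \<longleftrightarrow> x \<in> S"
  by (meson empty_subsetI insert_subset singletonI subsetD vec.span_base vec.span_minimal)

lemma card_cubic_points:
  assumes "vec.subspace S"
  shows "card {P \<in> twisted_cubic. P \<subseteq> S} = card {z \<in> proj_line. nu z \<in> S}"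
proof -
  have "{P \<in> twisted_cubic. P \<subseteq> S} = (\<lambda>z. vec.span {nu z}) ` {z \<in> proj_line. nu z \<in> S}"
    unfolding twisted_cubic_eq using span_singleton_subset[OF assms] by blast
  then show ?thesis
    by (simp add: card_image inj_on_subset[OF inj_on_span_nu])
qed

lemma external_line_iff:
  "external_line l \<longleftrightarrow> pg_line l \<and> (\<forall>z \<in> proj_line. nu z \<notin> l)"
proof -
  have "(\<forall>P \<in> twisted_cubic. \<not> P \<subseteq> l) \<longleftrightarrow> (\<forall>z \<in> proj_line. nu z \<notin> l)"
    if "vec.subspace l"
    by (simp add: twisted_cubic_eq span_singleton_subset[OF that])
  then show ?thesis by (auto simp: external_line_def pg_line_def)
qed

lemma nu_mem_cubic_plane:
  "nu z \<in> cubic_plane p m n \<longleftrightarrow> cross z p * cross z m * cross z n = 0"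
proof -
  have "cross z p * cross z m * cross z n =
     snd p * snd m * snd n * nu z $ 1
     + - (fst p * snd m * snd n + snd p * fst m * snd n + snd p * snd m * fst n) * nu z $ 2
     + (fst p * fst m * snd n + fst p * snd m * fst n + snd p * fst m * fst n) * nu z $ 3
     + - (fst p * fst m * fst n) * nu z $ 4"
    by (simp add: nu_def cross_def algebra_simps power2_eq_square power3_eq_cube)
  then show ?thesis by (simp add: cubic_plane_def plane_of_def)
qed

lemma subspace_cubic_plane: "vec.subspace (cubic_plane p m n)"
  by (simp add: cubic_plane_def subspace_plane_of)

lemma cubic_plane_rotate: "cubic_plane p m n = cubic_plane n p m"
  by (simp add: cubic_plane_def algebra_simps)

lemma axis_vec_mem_cubic_plane:
  "axis_vec r \<in> cubic_plane p m n \<longleftrightarrow>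
     fst r * (fst p * snd m * snd n + snd p * fst m * snd n + snd p * snd m * fst n)
     + snd r * (fst p * fst m * snd n + fst p * snd m * fst n + snd p * fst m * fst n) = 0"
proof -
  have "fst r * (fst p * snd m * snd n + snd p * fst m * snd n + snd p * snd m * fst n)
     + snd r * (fst p * fst m * snd n + fst p * snd m * fst n + snd p * fst m * fst n) =
     - (snd p * snd m * snd n * axis_vec r $ 1
     + - (fst p * snd m * snd n + snd p * fst m * snd n + snd p * snd m * fst n) * axis_vec r $ 2
     + (fst p * fst m * snd n + fst p * snd m * fst n + snd p * fst m * fst n) * axis_vec r $ 3
     + - (fst p * fst m * fst n) * axis_vec r $ 4)"
    by (simp add: axis_vec_def algebra_simps)
  then show ?thesis
    by (simp only: cubic_plane_def plane_of_def mem_Collect_eq neg_equal_0_iff_equal)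
qed

text \<open>Cramer's rule. The unknowns form one pair, so that unique existence can be turned into a
  solution set of cardinality 1.\<close>

lemma solve_2x2:
  fixes a b c d :: "'a::field"
  assumes "a * d - b * c \<noteq> 0"
  shows "\<exists>!xy. a * fst xy + b * snd xy = e \<and> c * fst xy + d * snd xy = f"
proof (rule ex1I)
  let ?D = "a * d - b * c"
  let ?x = "(e * d - b * f) / ?D" and ?y = "(a * f - c * e) / ?D"
  have div: "u * (x / z) + v * (y / z) = (u * x + v * y) / z" for u v x y z :: 'a
    by (simp add: add_divide_distrib)
  have "a * ?x + b * ?y = (a * (e * d - b * f) + b * (a * f - c * e)) / ?D"
    by (rule div)
  also have "a * (e * d - b * f) + b * (a * f - c * e) = e * ?D"
    by (simp add: algebra_simps)
  finally have 1: "a * ?x + b * ?y = e" using assms by simp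
  have "c * ?x + d * ?y = (c * (e * d - b * f) + d * (a * f - c * e)) / ?D"
    by (rule div)
  also have "c * (e * d - b * f) + d * (a * f - c * e) = f * ?D"
    by (simp add: algebra_simps)
  finally have 2: "c * ?x + d * ?y = f" using assms by simp
  show "a * fst (?x, ?y) + b * snd (?x, ?y) = e \<and> c * fst (?x, ?y) + d * snd (?x, ?y) = f"
    using 1 2 by simp
next
  fix xy assume h: "a * fst xy + b * snd xy = e \<and> c * fst xy + d * snd xy = f"
  have "fst xy * (a * d - b * c) = (a * fst xy + b * snd xy) * d - b * (c * fst xy + d * snd xy)"
    "snd xy * (a * d - b * c) = a * (c * fst xy + d * snd xy) - c * (a * fst xy + b * snd xy)"
    by (simp_all add: algebra_simps)
  then have "fst xy * (a * d - b * c) = e * d - b * f" "snd xy * (a * d - b * c) = a * f - c * e"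
    using h by simp_all
  then show "xy = ((e * d - b * f) / (a * d - b * c), (a * f - c * e) / (a * d - b * c))"
    using assms by (cases xy) (simp add: eq_divide_eq)
qed

lemma det_nonzero_imp_zero:
  fixes b c :: "'a::field"
  assumes "b * x + c * y = 0" "b * x' + c * y' = 0" "x * y' - x' * y \<noteq> 0"
  shows "b = 0 \<and> c = 0"
proof -
  have "b * (x * y' - x' * y) = (b * x + c * y) * y' - (b * x' + c * y') * y"
    "c * (x * y' - x' * y) = (b * x' + c * y') * x - (b * x + c * y) * x'"
    by (simp_all add: algebra_simps)
  then show ?thesis using assms by simp
qed

lemma proj_line_nonzero: "z \<in> proj_line \<Longrightarrow> fst z = 0 \<Longrightarrow> snd z \<noteq> 0"
  by (auto simp: proj_line_def)

section \<open>Planes meeting the cubic in exactly two points\<close>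

text \<open>Order matters: \<open>p\<close> stands for the double root and \<open>m\<close> for the
  simple one, so \<open>(p, m)\<close> and \<open>(m, p)\<close> belong to different planes.\<close>

definition flags :: "(('a::field \<times> 'a) \<times> ('a \<times> 'a)) set" where
  "flags = {(p, m). p \<in> proj_line \<and> m \<in> proj_line \<and> p \<noteq> m}"

section \<open>Arithmetic in characteristic 3 and the points of the axis\<close>

locale char3_field =
  fixes T :: "'a::{field,finite} itself"
  assumes card_power_3: "\<exists>h. CARD('a) = 3 ^ h"
begin

text \<open>The characteristic divides the number of elements, so a power of 3 vanishes in the
  field, which has no nilpotent elements.\<close>

lemma three_eq_0: "(3::'a) = 0"
proof -
  obtain h where h: "CARD('a) = 3 ^ h" using card_power_3 by blast
  have "of_nat CARD('a) = (0::'a)"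
    using CHAR_dvd_CARD by (simp add: of_nat_eq_0_iff_char_dvd)
  then show ?thesis unfolding h by simp
qed

lemma two_eq: "(2::'a) = - 1"
proof -
  have "(2::'a) + 1 = 0" using three_eq_0 by simp
  then show ?thesis by (rule eq_neg_iff_add_eq_0[THEN iffD2])
qed

lemma cube_diff: "x ^ 3 - y ^ 3 = (x - y :: 'a) ^ 3"
proof -
  have "(x - y) ^ 3 = x ^ 3 - y ^ 3 + 3 * (x * y * y - x * x * y)"
    by (simp add: algebra_simps power3_eq_cube)
  then show ?thesis by (simp add: three_eq_0)
qed

lemma cube_eq_iff: "x ^ 3 = (y :: 'a) ^ 3 \<longleftrightarrow> x = y"
  using cube_diff[of x y] by auto

lemma cube_surj: obtains y where "(x :: 'a) = y ^ 3"
proof -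
  have "surj (\<lambda>y :: 'a. y ^ 3)"
    by (rule finite_UNIV_inj_surj) (auto simp: inj_def cube_eq_iff)
  then show ?thesis using that by (metis surjD)
qed

text \<open>Projection from the axis cubes both coordinates of a parameter, and additivity of cubing
  carries this over to determinants. Distinct cubic points therefore stay distinct after projection,
  which underlies the independence arguments below.\<close>

lemma cross_cube: "fst z ^ 3 * snd w ^ 3 - snd z ^ 3 * fst w ^ 3 = (cross z w :: 'a) ^ 3"
  by (simp add: cross_def cube_diff flip: power_mult_distrib)

text \<open>Three elements give the projective line four points, one more than a nonzero binary
  cubic can have as roots.\<close>

lemma card_field_ge_3: "3 \<le> CARD('a)"
proof -
  have "(1 :: 'a) \<noteq> - 1"
  proof
    assume "(1 :: 'a) = - 1"
    then have "(2 :: 'a) = 0" by (metis one_add_one add.right_inverse)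
    then show False using two_eq by simp
  qed
  then have "card {0, 1, - 1 :: 'a} = 3" by simp
  then show ?thesis by (metis card_mono finite subset_UNIV)
qed

text \<open>With \<open>3 = 0\<close> the two middle coefficients of every \<Gamma>-plane vanish;
  the planes for \<open>t = 0\<close> and for infinity already cut out the axis, and all the others
  contain it.\<close>

lemma axis_eq: "(axis :: ('a ^ 4) set) = {x. x $ 1 = 0 \<and> x $ 4 = 0}"
proof -
  have "x $ 1 = 0" if "\<And>t. x \<in> plane_of 1 (- 3 * t) (3 * t ^ 2) (- (t ^ 3))" for x :: "'a ^ 4"
    using that[of 0] by (simp add: plane_of_def)
  then show ?thesis
    by (auto simp: axis_def Gamma_planes_def plane_of_def three_eq_0)
qed

lemma Gamma_plane_eq:
  "plane_of 1 (- 3 * t) (3 * t ^ 2) (- (t ^ 3)) = {x :: 'a ^ 4. x $ 1 = t ^ 3 * x $ 4}"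
  by (simp add: plane_of_def three_eq_0)

lemma axis_vec_in_axis: "axis_vec (r :: 'a \<times> 'a) \<in> axis"
  by (simp add: axis_vec_def axis_eq)

lemma axis_representative:
  assumes "(x :: 'a ^ 4) \<in> axis" "x \<noteq> 0"
  obtains r c where "r \<in> proj_line" "c \<noteq> 0" "x = c *s axis_vec r"
proof -
  have "(x $ 2, - x $ 3) \<noteq> (0, 0)" using assms by (auto simp: axis_eq vec4_eq_iff)
  then obtain r c where r: "r \<in> proj_line" "c \<noteq> 0" "(x $ 2, - x $ 3) = (c * fst r, c * snd r)"
    by (rule proj_line_representative)
  have "x = c *s axis_vec r" using r(3) assms(1)
    by (auto simp: axis_eq vec4_eq_iff axis_vec_def minus_equation_iff)
  with r that show ?thesis by blast
qed

lemma axis_vec_nonzero: "r \<in> proj_line \<Longrightarrow> axis_vec (r :: 'a \<times> 'a) \<noteq> 0"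
  by (auto simp: axis_vec_def vec4_eq_iff proj_line_def)

text \<open>The axis vector has no outer coordinates, so these involve \<open>b\<close> and
  \<open>c\<close> alone, with the cube of \<open>cross p m\<close> as determinant.\<close>

lemma lin_indep3_axis_nu_nu:
  assumes "r \<in> proj_line" "p \<in> proj_line" "m \<in> proj_line" "p \<noteq> (m :: 'a \<times> 'a)"
  shows "lin_indep3 (axis_vec r) (nu p) (nu m)"
  unfolding lin_indep3_def
proof (intro allI impI)
  fix a b c assume e: "a *s axis_vec r + b *s nu p + c *s nu m = 0"
  have "b * fst p ^ 3 + c * fst m ^ 3 = 0" "b * snd p ^ 3 + c * snd m ^ 3 = 0"
    using e by (auto simp: vec4_eq_iff axis_vec_def nu_def)
  moreover have "fst p ^ 3 * snd m ^ 3 - snd p ^ 3 * fst m ^ 3 \<noteq> 0"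
    using assms by (simp add: cross_cube cross_eq_0_iff)
  ultimately have bc: "b = 0 \<and> c = 0" by (rule det_nonzero_imp_zero)
  then have "a *s axis_vec r = 0" using e by simp
  then show "a = 0 \<and> b = 0 \<and> c = 0" using bc axis_vec_nonzero[OF assms(1)] by simp
qed

text \<open>Since cubing is additive, the outer coordinates of two distinct points of the cubic are independent,
  so any third vector of the plane can be moved into the axis.\<close>

lemma plane_contains_axis_vec:
  assumes "pg_plane E" "nu p \<in> E" "nu m \<in> E" "p \<in> proj_line" "m \<in> proj_line" "p \<noteq> (m :: 'a \<times> 'a)"
  obtains r where "r \<in> proj_line" "axis_vec r \<in> E"
proof -
  have sub: "vec.subspace E" using assms(1) by (simp add: pg_plane_def)
  have "\<not> E \<subseteq> vec.span {nu p, nu m}"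
  proof
    assume "E \<subseteq> vec.span {nu p, nu m}"
    then have "vec.dim E \<le> vec.dim {nu p, nu m}" by (rule vec.dim_mono)
    also have "\<dots> \<le> card {nu p, nu m}" by (rule vec.dim_le_card) (auto simp: vec.span_superset)
    also have "\<dots> \<le> 2" by (simp add: card_insert_if)
    finally show False using assms(1) by (simp add: pg_plane_def)
  qed
  then obtain w where w: "w \<in> E" "w \<notin> vec.span {nu p, nu m}" by blast
  have "fst p ^ 3 * snd m ^ 3 - fst m ^ 3 * snd p ^ 3 \<noteq> 0"
    using assms by (simp add: cross_cube cross_eq_0_iff mult.commute[of "fst m ^ 3"])
  from solve_2x2[OF this, of "w $ 1" "w $ 4"] obtain b c where
    bc: "fst p ^ 3 * b + fst m ^ 3 * c = w $ 1" "snd p ^ 3 * b + snd m ^ 3 * c = w $ 4"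
    by auto
  let ?x = "w - (b *s nu p + c *s nu m)"
  have "?x \<in> E" using sub w(1) assms(2,3) by (intro vec.subspace_diff subspace_comb2)
  moreover have "?x \<in> axis" using bc by (simp add: axis_eq nu_def mult.commute)
  moreover have "?x \<noteq> 0" using w(2) by (auto simp: mem_span2)
  ultimately obtain r d where r: "r \<in> proj_line" "d \<noteq> 0" "?x = d *s axis_vec r" "d *s axis_vec r \<in> E"
    using axis_representative by metis
  then have "(1 / d) *s (d *s axis_vec r) \<in> E" using vec.subspace_scale[OF sub] by blast
  then have "axis_vec r \<in> E" using r(2) by simp
  with r(1) show ?thesis by (rule that)
qed

text \<open>A fourth parameter \<open>z\<close>, different from the three roots, gives a cubic point
  off the plane, so the equation is not trivial.\<close>

lemma pg_plane_cubic_plane: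
  assumes "p \<in> proj_line" "m \<in> proj_line" "n \<in> proj_line"
  shows "pg_plane (cubic_plane p m (n :: 'a \<times> 'a))"
proof -
  have "\<not> proj_line \<subseteq> {p, m, n}"
  proof
    assume "proj_line \<subseteq> {p, m, n}"
    then have "card (proj_line :: ('a \<times> 'a) set) \<le> card {p, m, n}" by (intro card_mono) auto
    also have "\<dots> \<le> 3" by (simp add: card_insert_if)
    finally show False using card_field_ge_3 by (simp add: card_proj_line)
  qed
  then obtain z where "z \<in> proj_line" "z \<noteq> p" "z \<noteq> m" "z \<noteq> n" by blast
  then have "nu z \<notin> cubic_plane p m n"
    using assms by (simp add: nu_mem_cubic_plane cross_eq_0_iff)
  then show ?thesis unfolding cubic_plane_def by (rule pg_plane_plane_of)
qed

text \<open>A double root makes each mixed product occur twice, and \<open>2 = - 1\<close> turns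
  these sums into differences: up to sign the two middle coefficients are \<open>snd p\<close> and
  \<open>fst p\<close> times \<open>cross p m\<close>. Pairing them with \<open>r\<close> yields
  \<open>cross p r\<close>.\<close>

lemma axis_vec_mem_double_plane:
  "axis_vec r \<in> cubic_plane p p m \<longleftrightarrow> cross p m * cross p r = (0 :: 'a)"
proof -
  have "fst r * (fst p * snd p * snd m + snd p * fst p * snd m + snd p * snd p * fst m)
     + snd r * (fst p * fst p * snd m + fst p * snd p * fst m + snd p * fst p * fst m)
     = cross p m * cross p r + 3 * (fst r * fst p * snd p * snd m + snd r * fst p * snd p * fst m)"
    by (simp add: cross_def algebra_simps)
  also have "\<dots> = cross p m * cross p r" by (simp add: three_eq_0)
  finally show ?thesis unfolding axis_vec_mem_cubic_plane by simp
qed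

lemma nu_mem_double_plane:
  assumes "z \<in> proj_line" "p \<in> proj_line" "m \<in> proj_line"
  shows "nu z \<in> cubic_plane p p m \<longleftrightarrow> z = p \<or> z = (m :: 'a \<times> 'a)"
  using assms by (auto simp: nu_mem_cubic_plane cross_eq_0_iff)

text \<open>A plane through two given cubic points is determined by an axis point on it. To identify
  such a plane it suffices to find a root \<open>n\<close> whose plane passes through the same axis
  point.\<close>

lemma plane_is_cubic_plane:
  assumes "pg_plane E" "axis_vec r \<in> E" "nu p \<in> E" "nu m \<in> E"
    and "r \<in> proj_line" "p \<in> proj_line" "m \<in> proj_line" "n \<in> proj_line" "p \<noteq> (m :: 'a \<times> 'a)"
    and "axis_vec r \<in> cubic_plane p m n"
  shows "E = cubic_plane p m n"
proof -
  have i: "lin_indep3 (axis_vec r) (nu p) (nu m)" using assms by (intro lin_indep3_axis_nu_nu)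
  have "E = vec.span {axis_vec r, nu p, nu m}"
    by (rule pg_plane_eq_span[OF assms(1-4) i])
  moreover have "cubic_plane p m n = vec.span {axis_vec r, nu p, nu m}"
    using assms by (intro pg_plane_eq_span[OF _ _ _ _ i] pg_plane_cubic_plane)
      (auto simp: nu_mem_cubic_plane cross_def)
  ultimately show ?thesis by simp
qed

text \<open>The incidence of \<open>axis_vec r\<close> with \<open>cubic_plane p m n\<close> is linear in \<open>n\<close>; \<open>(n1, n2)\<close> is its solution.\<close>

lemma third_cubic_point:
  assumes "r \<in> proj_line" "p \<in> proj_line" "m \<in> proj_line" "p \<noteq> m" "r \<noteq> p" "r \<noteq> (m :: 'a \<times> 'a)"
  obtains n where "n \<in> proj_line" "n \<noteq> p" "n \<noteq> m" "axis_vec r \<in> cubic_plane p m n"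
proof -
  define n1 where "n1 = - (fst p * fst m * snd r + fst r * fst p * snd m + fst r * fst m * snd p)"
  define n2 where "n2 = fst r * snd p * snd m + fst p * snd r * snd m + fst m * snd r * snd p"
  \<comment> \<open>Modulo 3 the determinant of \<open>(n1, n2)\<close> with \<open>p\<close>
    factors, and both factors are nonzero because \<open>m\<close> and \<open>r\<close> differ from
    \<open>p\<close>. This separates the new root from \<open>p\<close>; the same is done for
    \<open>m\<close>.\<close>
  have "n1 * snd p - n2 * fst p = - (cross m p * cross r p)
      - 3 * (fst p * fst m * snd r * snd p + fst r * fst p * snd p * snd m)"
    by (simp add: n1_def n2_def cross_def algebra_simps)
  then have np: "n1 * snd p - n2 * fst p \<noteq> 0"
    using assms by (simp add: three_eq_0 cross_eq_0_iff)
  have "n1 * snd m - n2 * fst m = - (cross p m * cross r m)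
      - 3 * (fst p * fst m * snd r * snd m + fst r * fst m * snd p * snd m)"
    by (simp add: n1_def n2_def cross_def algebra_simps)
  then have nm: "n1 * snd m - n2 * fst m \<noteq> 0"
    using assms by (simp add: three_eq_0 cross_eq_0_iff)
  have "(n1, n2) \<noteq> (0, 0)" using np by auto
  then obtain n c where n: "n \<in> proj_line" "c \<noteq> 0" "(n1, n2) = (c * fst n, c * snd n)"
    by (rule proj_line_representative)
  have "c * (fst r * (fst p * snd m * snd n + snd p * fst m * snd n + snd p * snd m * fst n)
     + snd r * (fst p * fst m * snd n + fst p * snd m * fst n + snd p * fst m * fst n)) =
     n2 * (fst r * (fst p * snd m + snd p * fst m) + snd r * fst p * fst m)
     + n1 * (fst r * snd p * snd m + snd r * (fst p * snd m + snd p * fst m))"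
    using n(3) by (simp add: algebra_simps)
  also have "\<dots> = n2 * (- n1) + n1 * n2" by (simp add: n1_def n2_def algebra_simps)
  finally have "axis_vec r \<in> cubic_plane p m n"
    using n(2) by (simp add: axis_vec_mem_cubic_plane)
  moreover have "n \<noteq> p" "n \<noteq> m" using np nm n(3) by auto
  ultimately show ?thesis using that n(1) by blast
qed

text \<open>The plane is classified by its axis point \<open>r\<close>. If \<open>r\<close> is one
  of the two cubic parameters, that parameter is the double root. Otherwise the root completing
  \<open>p\<close> and \<open>m\<close> would be a third cubic point in the plane.\<close>

lemma two_C_planes_eq:
  "(two_C_planes :: ('a ^ 4) set set) = (\<lambda>(p, m). cubic_plane p p m) ` flags"
proof (intro equalityI subsetI)
  fix E :: "('a ^ 4) set" assume "E \<in> two_C_planes"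
  then have E: "pg_plane E" "card {z \<in> proj_line. nu z \<in> E} = 2"
    by (auto simp: two_C_planes_def card_cubic_points pg_plane_def)
  then obtain p m where pm: "{z \<in> proj_line. nu z \<in> E} = {p, m}" "p \<noteq> m"
    by (auto simp: card_2_iff)
  then have P: "p \<in> proj_line" "m \<in> proj_line" "nu p \<in> E" "nu m \<in> E" by auto
  obtain r where r: "r \<in> proj_line" "axis_vec r \<in> E"
    using plane_contains_axis_vec[OF E(1) P(3,4,1,2) pm(2)] .
  show "E \<in> (\<lambda>(p, m). cubic_plane p p m) ` flags"
  proof (cases "r = p \<or> r = m")
    case True
    then show ?thesis
    proof
      assume "r = p"
      then have "axis_vec r \<in> cubic_plane p p m"
        by (simp add: axis_vec_mem_double_plane cross_def)
      then have "axis_vec r \<in> cubic_plane p m p" by (simp add: cubic_plane_rotate[of p m p])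
      then have "E = cubic_plane p m p"
        using plane_is_cubic_plane[OF E(1) r(2) P(3,4) r(1) P(1,2,1) pm(2)] by blast
      then have "E = cubic_plane p p m" by (simp add: cubic_plane_rotate[of p m p])
      then show ?thesis using P pm by (force simp: flags_def)
    next
      assume "r = m"
      then have "axis_vec r \<in> cubic_plane m m p"
        by (simp add: axis_vec_mem_double_plane cross_def)
      then have "axis_vec r \<in> cubic_plane p m m"
        by (metis cubic_plane_rotate)
      then have "E = cubic_plane p m m"
        using plane_is_cubic_plane[OF E(1) r(2) P(3,4) r(1) P(1,2,2) pm(2)] by blast
      then have "E = cubic_plane m m p" by (metis cubic_plane_rotate)
      then show ?thesis using P pm by (force simp: flags_def)
    qed
  next
    case False
    then obtain n where n: "n \<in> proj_line" "n \<noteq> p" "n \<noteq> m" "axis_vec r \<in> cubic_plane p m n"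
      using third_cubic_point[OF r(1) P(1,2) pm(2)] by blast
    have "E = cubic_plane p m n"
      using plane_is_cubic_plane[OF E(1) r(2) P(3,4) r(1) P(1,2) n(1) pm(2) n(4)] .
    then have "nu n \<in> E" by (simp add: nu_mem_cubic_plane cross_def)
    then have "n \<in> {p, m}" using n(1) pm(1) by blast
    with n show ?thesis by blast
  qed
next
  fix E :: "('a ^ 4) set" assume "E \<in> (\<lambda>(p, m). cubic_plane p p m) ` flags"
  then obtain p m where E: "E = cubic_plane p p m" and pm: "p \<in> proj_line" "m \<in> proj_line" "p \<noteq> m"
    by (auto simp: flags_def)
  have pl: "pg_plane E" using pm by (simp add: E pg_plane_cubic_plane)
  have "{z \<in> proj_line. nu z \<in> E} = {p, m}"
    using pm by (auto simp: E nu_mem_double_plane)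
  then have "card {z \<in> proj_line. nu z \<in> E} = 2" using pm(3) by simp
  with pl show "E \<in> two_C_planes"
    by (simp add: two_C_planes_def card_cubic_points pg_plane_def)
qed

text \<open>The plane remembers \<open>p\<close> through its only axis point, and then
  \<open>m\<close> as the parameter of its other cubic point.\<close>

lemma inj_on_double_plane: "inj_on (\<lambda>(p, m). cubic_plane p p (m :: 'a \<times> 'a)) flags"
proof (rule inj_onI, clarify)
  fix p m p' m' :: "'a \<times> 'a"
  assume f: "(p, m) \<in> flags" "(p', m') \<in> flags" and e: "cubic_plane p p m = cubic_plane p' p' m'"
  have P: "p \<in> proj_line" "m \<in> proj_line" "p \<noteq> m" "p' \<in> proj_line" "m' \<in> proj_line" "p' \<noteq> m'"
    using f by (auto simp: flags_def)
  have "axis_vec p \<in> cubic_plane p' p' m'"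
    unfolding e[symmetric] axis_vec_mem_double_plane by (simp add: cross_def)
  then have p: "p' = p" using P by (simp add: axis_vec_mem_double_plane cross_eq_0_iff)
  have "nu m \<in> cubic_plane p' p' m'"
    unfolding e[symmetric] nu_mem_cubic_plane by (simp add: cross_def)
  then have "m = m'" using P p by (simp add: nu_mem_double_plane)
  with p show "p = p' \<and> m = m'" by simp
qed

lemma card_two_C_planes: "card (two_C_planes :: ('a ^ 4) set set) = (CARD('a) + 1) * CARD('a)"
proof -
  have "(flags :: (('a \<times> 'a) \<times> ('a \<times> 'a)) set) = (SIGMA p : proj_line. proj_line - {p})"
    by (auto simp: flags_def)
  moreover have "card (SIGMA p : proj_line. (proj_line - {p} :: ('a \<times> 'a) set))
      = (\<Sum>p \<in> (proj_line :: ('a \<times> 'a) set). CARD('a))"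
    by (subst card_SigmaI) (auto simp: card_proj_line intro!: sum.cong)
  ultimately have "card (flags :: (('a \<times> 'a) \<times> ('a \<times> 'a)) set) = (CARD('a) + 1) * CARD('a)"
    by (simp add: card_proj_line)
  then show ?thesis
    by (simp add: two_C_planes_eq card_image[OF inj_on_double_plane])
qed

end

section \<open>Lines meeting the axis\<close>

lemma lin_indep3_eqD:
  assumes "lin_indep3 u v w" "a *s u + b *s v + c *s w = a' *s u + b' *s v + c' *s w"
  shows "a = a' \<and> b = b' \<and> c = c'"
proof -
  have "(a - a') *s u + (b - b') *s v + (c - c') *s w = 0"
    using assms(2) by (simp add: vec.scale_left_diff_distrib algebra_simps)
  then show ?thesis using assms(1) unfolding lin_indep3_def by fastforce
qed

lemma lin_indep3_comb:
  assumes "lin_indep3 u v w"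
  shows "lin_indep2 u (v + k *s w)"
  unfolding lin_indep2_def
proof (intro allI impI)
  fix a b assume "a *s u + b *s (v + k *s w) = 0"
  then have "a *s u + b *s v + (b * k) *s w = 0"
    by (simp add: vec.scale_right_distrib add.assoc)
  then show "a = 0 \<and> b = 0" using assms unfolding lin_indep3_def by blast
qed

text \<open>A vector completing \<open>axis_vec r\<close> to a basis of the axis, for normalised \<open>r\<close>.\<close>

definition axis_compl :: "'a::field \<times> 'a \<Rightarrow> 'a ^ 4" where
  "axis_compl r = vector [0, snd r, 1 - snd r, 0]"

text \<open>The line meets the axis in \<open>axis_vec r\<close>, and together with the axis it
  spans the \<Gamma>-plane through \<open>nu z\<close>. The scalar \<open>k\<close> is the
  displacement from the cubic point inside that plane, so \<open>k = 0\<close> would be the line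
  through \<open>nu z\<close>.\<close>

definition EA_line :: "(('a::field \<times> 'a) \<times> ('a \<times> 'a)) \<times> 'a \<Rightarrow> ('a ^ 4) set" where
  "EA_line = (\<lambda>((r, z), k). vec.span {axis_vec r, nu z + k *s axis_compl r})"

context char3_field
begin

lemma EA_lines_iff:
  "l \<in> EA_lines \<longleftrightarrow> external_line l \<and> l \<noteq> axis \<and> (\<exists>r \<in> proj_line. axis_vec (r :: 'a \<times> 'a) \<in> l)"
proof -
  have "(\<exists>P. pg_point P \<and> P \<subseteq> l \<and> P \<subseteq> axis) \<longleftrightarrow> (\<exists>r \<in> proj_line. axis_vec r \<in> l)"
    if sub: "vec.subspace l"
  proof
    assume "\<exists>P. pg_point P \<and> P \<subseteq> l \<and> P \<subseteq> axis"
    then obtain P :: "('a ^ 4) set" where P: "vec.dim P = 1" "P \<subseteq> l" "P \<subseteq> axis"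
      by (auto simp: pg_point_def)
    then obtain x where x: "x \<in> P" "x \<noteq> 0"
      by (metis vec.dim_eq_0 One_nat_def insertCI subsetI nat.distinct(1))
    then obtain r c where r: "r \<in> proj_line" "c \<noteq> 0" "x = c *s axis_vec r"
      using axis_representative P(3) by blast
    have "c *s axis_vec r \<in> l" using x(1) P(2) unfolding r(3) by blast
    then have "(1 / c) *s (c *s axis_vec r) \<in> l" using vec.subspace_scale[OF sub] by blast
    then show "\<exists>r \<in> proj_line. axis_vec r \<in> l" using r by auto
  next
    assume "\<exists>r \<in> proj_line. axis_vec r \<in> l"
    then obtain r where r: "r \<in> proj_line" "axis_vec r \<in> l" by blast
    have "vec.subspace (axis :: ('a ^ 4) set)" by (auto simp: axis_eq vec.subspace_def)
    then have "vec.span {axis_vec r} \<subseteq> axis" "vec.span {axis_vec r} \<subseteq> l"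
      using r axis_vec_in_axis sub by (simp_all add: span_singleton_subset)
    moreover have "pg_point (vec.span {axis_vec r})"
      using axis_vec_nonzero[OF r(1)] by (simp add: pg_point_def)
    ultimately show "\<exists>P. pg_point P \<and> P \<subseteq> l \<and> P \<subseteq> axis" by blast
  qed
  then show ?thesis by (auto simp: EA_lines_def external_line_def pg_line_def)
qed

lemma double_plane_eq_span:
  assumes "(p, m) \<in> flags"
  shows "lin_indep3 (axis_vec p) (nu p) (nu (m :: 'a \<times> 'a))"
    and "cubic_plane p p m = vec.span {axis_vec p, nu p, nu m}"
proof -
  have P: "p \<in> proj_line" "m \<in> proj_line" "p \<noteq> m" using assms by (auto simp: flags_def)
  show i: "lin_indep3 (axis_vec p) (nu p) (nu m)"
    using P by (intro lin_indep3_axis_nu_nu)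
  show "cubic_plane p p m = vec.span {axis_vec p, nu p, nu m}"
    using P by (intro pg_plane_eq_span[OF _ _ _ _ i] pg_plane_cubic_plane)
      (auto simp: nu_mem_cubic_plane axis_vec_mem_double_plane cross_def)
qed

text \<open>Since \<open>axis_vec p\<close> is the only axis point of the plane, the candidates are
  the \<open>q + 1\<close> lines of a pencil. With the coefficient of \<open>nu p\<close> scaled to
  1, the line through \<open>nu m\<close> does not occur and \<open>k = 0\<close> is the line
  through \<open>nu p\<close>.\<close>

lemma EA_lines_in_double_plane:
  assumes f: "(p, m) \<in> flags"
  shows "{l \<in> EA_lines. l \<subseteq> cubic_plane p p m} =
    (\<lambda>k. vec.span {axis_vec p, nu p + k *s nu (m :: 'a \<times> 'a)}) ` (UNIV - {0})"
proof (intro equalityI subsetI)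
  have P: "p \<in> proj_line" "m \<in> proj_line" "p \<noteq> m" using f by (auto simp: flags_def)
  note i = double_plane_eq_span(1)[OF f] and E = double_plane_eq_span(2)[OF f]
  {
    fix l assume "l \<in> {l \<in> EA_lines. l \<subseteq> cubic_plane p p m}"
    then have l: "external_line l" "\<exists>r \<in> proj_line. axis_vec r \<in> l" "l \<subseteq> cubic_plane p p m"
      by (auto simp: EA_lines_iff)
    then obtain r where r: "r \<in> proj_line" "axis_vec r \<in> l" by blast
    then have "axis_vec r \<in> cubic_plane p p m" using l(3) by blast
    then have "r = p" using P r(1) by (simp add: axis_vec_mem_double_plane cross_eq_0_iff)
    then have A: "axis_vec p \<in> l" using r by simp
    have ext: "nu z \<notin> l" if "z \<in> proj_line" for z
      using l(1) that by (auto simp: external_line_iff)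
    have ln: "pg_line l" using l(1) by (simp add: external_line_iff)
    obtain v where v: "lin_indep2 (axis_vec p) v" "l = vec.span {axis_vec p, v}"
      using pg_line_basis_extend[OF ln A axis_vec_nonzero[OF P(1)]] .
    have vl: "v \<in> l" unfolding v(2) by (simp add: vec.span_base)
    then have "v \<in> vec.span {axis_vec p, nu p, nu m}" using l(3) E by blast
    then obtain a b c where abc: "v = a *s axis_vec p + b *s nu p + c *s nu m"
      by (auto simp: mem_span3)
    have "1 *s v + (- a) *s axis_vec p \<in> l" by (rule pg_line_comb[OF ln vl A])
    then have bc: "b *s nu p + c *s nu m \<in> l" by (simp add: abc algebra_simps)
    have sc: "k *s x \<in> l" if "x \<in> l" for k x
      using ln that by (simp add: pg_line_def vec.subspace_scale)
    have "b \<noteq> 0"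
    proof
      assume b: "b = 0"
      have "c \<noteq> 0"
      proof
        assume "c = 0"
        then have "a *s axis_vec p + (- 1) *s v = 0" using abc b by simp
        then show False using v(1) unfolding lin_indep2_def by (metis neg_equal_0_iff_equal zero_neq_one)
      qed
      moreover have "c *s nu m \<in> l" using bc b by simp
      from sc[OF this, of "1 / c"] have "c = 0 \<or> nu m \<in> l"
        by (cases "c = 0") auto
      ultimately show False using ext[OF P(2)] by simp
    qed
    moreover have "c \<noteq> 0"
    proof
      assume "c = 0"
      then have "b *s nu p \<in> l" using bc by simp
      from sc[OF this, of "1 / b"] show False using ext[OF P(1)] \<open>b \<noteq> 0\<close> by simp
    qed
    moreover have "(1 / b) *s (b *s nu p + c *s nu m) \<in> l" using sc bc by blast
    then have u: "nu p + (c / b) *s nu m \<in> l" using \<open>b \<noteq> 0\<close>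
      by (simp add: vec.scale_right_distrib)
    have "l = vec.span {axis_vec p, nu p + (c / b) *s nu m}"
      by (rule pg_line_eq_span[OF ln A u lin_indep3_comb[OF i]])
    ultimately show "l \<in> (\<lambda>k. vec.span {axis_vec p, nu p + k *s nu m}) ` (UNIV - {0})" by simp
  next
    fix l assume "l \<in> (\<lambda>k. vec.span {axis_vec p, nu p + k *s nu m}) ` (UNIV - {0})"
    then obtain k where k: "k \<noteq> 0" "l = vec.span {axis_vec p, nu p + k *s nu m}" by blast
    have ln: "pg_line l" unfolding k(2) by (rule pg_line_span[OF lin_indep3_comb[OF i]])
    have sub: "l \<subseteq> cubic_plane p p m" unfolding k(2) E
      by (intro vec.span_minimal vec.subspace_span) (auto intro: vec.span_add vec.span_scale vec.span_base)
    have "nu z \<notin> l" if z: "z \<in> proj_line" for z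
    proof
      assume zl: "nu z \<in> l"
      then obtain x y where "nu z = x *s axis_vec p + y *s (nu p + k *s nu m)"
        unfolding k(2) by (auto simp: mem_span2)
      then have e: "nu z = x *s axis_vec p + y *s nu p + (y * k) *s nu m"
        by (simp add: vec.scale_right_distrib add.assoc)
      have "z = p \<or> z = m" using zl sub nu_mem_double_plane[OF z P(1,2)] by blast
      then show False
      proof
        assume "z = p"
        then have "0 *s axis_vec p + 1 *s nu p + 0 *s nu m = x *s axis_vec p + y *s nu p + (y * k) *s nu m"
          using e by simp
        then show False using lin_indep3_eqD[OF i] k(1) by fastforce
      next
        assume "z = m"
        then have "0 *s axis_vec p + 0 *s nu p + 1 *s nu m = x *s axis_vec p + y *s nu p + (y * k) *s nu m"
          using e by simp
        then show False using lin_indep3_eqD[OF i] k(1) by fastforce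
      qed
    qed
    \<comment> \<open>An axis point off the plane: the axis is not contained in it, hence differs
      from \<open>l\<close>.\<close>
    moreover have "axis_vec m \<notin> cubic_plane p p m"
      using P by (simp add: axis_vec_mem_double_plane cross_eq_0_iff)
    then have "l \<noteq> axis" using sub axis_vec_in_axis by blast
    moreover have "axis_vec p \<in> l" unfolding k(2) by (simp add: vec.span_base)
    ultimately show "l \<in> {l \<in> EA_lines. l \<subseteq> cubic_plane p p m}"
      using ln sub P(1) by (auto simp: EA_lines_iff external_line_iff)
  }
qed

lemma card_EA_lines_in_plane:
  assumes "E \<in> (two_C_planes :: ('a ^ 4) set set)"
  shows "num_lines_in EA_lines E = CARD('a) - 1"
proof -
  obtain p m where f: "(p, m) \<in> flags" and E: "E = cubic_plane p p m"
    using assms by (auto simp: two_C_planes_eq)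
  note i = double_plane_eq_span(1)[OF f]
  have "inj_on (\<lambda>k. vec.span {axis_vec p, nu p + k *s nu m}) (UNIV - {0})"
  proof (rule inj_onI)
    fix k k' :: 'a
    assume "vec.span {axis_vec p, nu p + k *s nu m} = vec.span {axis_vec p, nu p + k' *s nu m}"
    then have "nu p + k *s nu m \<in> vec.span {axis_vec p, nu p + k' *s nu m}"
      by (metis insertCI vec.span_base)
    then obtain x y where "nu p + k *s nu m = x *s axis_vec p + y *s (nu p + k' *s nu m)"
      by (auto simp: mem_span2)
    then have "0 *s axis_vec p + 1 *s nu p + k *s nu m = x *s axis_vec p + y *s nu p + (y * k') *s nu m"
      by (simp add: vec.scale_right_distrib add.assoc)
    then show "k = k'" using lin_indep3_eqD[OF i] by fastforce
  qed
  then show ?thesis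
    unfolding num_lines_in_def E EA_lines_in_double_plane[OF f] by (simp add: card_image card_Diff_singleton)
qed

section \<open>Parametrisation and number of all EA-lines\<close>

lemma lin_indep3_axis_nu_compl:
  assumes "r \<in> proj_line" "z \<in> proj_line"
  shows "lin_indep3 (axis_vec r) (nu z) (axis_compl (r :: 'a \<times> 'a))"
  unfolding lin_indep3_def
proof (intro allI impI)
  fix a b c assume e: "a *s axis_vec r + b *s nu z + c *s axis_compl r = 0"
  then have "b * fst z ^ 3 = 0" "b * snd z ^ 3 = 0"
    by (auto simp: vec4_eq_iff axis_vec_def axis_compl_def nu_def)
  then have b: "b = 0" using proj_line_nonzero[OF assms(2)] by auto
  then have "a * fst r + c * snd r = 0" "- (a * snd r) + c * (1 - snd r) = 0"
    using e by (auto simp: vec4_eq_iff axis_vec_def axis_compl_def)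
  then show "a = 0 \<and> b = 0 \<and> c = 0"
    using assms(1) b by (auto simp: proj_line_def)
qed

lemma axis_decompose:
  assumes "r \<in> proj_line" "x \<in> axis"
  obtains a b where "x = a *s axis_vec r + b *s axis_compl (r :: 'a \<times> 'a)"
proof (cases "snd r = 0")
  case True
  then have "x = (x $ 2) *s axis_vec r + (x $ 3) *s axis_compl r"
    using assms by (auto simp: proj_line_def axis_eq axis_vec_def axis_compl_def vec4_eq_iff)
  then show ?thesis by (rule that)
next
  case False
  then have "x = (- (x $ 3)) *s axis_vec r + (x $ 2 + x $ 3 * fst r) *s axis_compl r"
    using assms by (auto simp: proj_line_def axis_eq axis_vec_def axis_compl_def vec4_eq_iff)
  then show ?thesis by (rule that)
qed

text \<open>This is injectivity of the projection of the cubic from the axis: proportional cubes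
  have determinant zero, hence so do the parameters.\<close>

lemma proj_line_cube_eq:
  assumes "z \<in> proj_line" "w \<in> proj_line"
    and "fst w ^ 3 = c * fst z ^ 3" "snd w ^ 3 = c * snd z ^ 3"
  shows "w = (z :: 'a \<times> 'a)"
proof -
  have "cross w z ^ 3 = 0"
    by (simp add: assms algebra_simps flip: cross_cube)
  then show ?thesis using assms by (simp add: cross_eq_0_iff)
qed

lemma pg_line_axis: "pg_line (axis :: ('a ^ 4) set)"
proof -
  let ?r = "(1, 0) :: 'a \<times> 'a"
  have r: "?r \<in> proj_line" by (simp add: proj_line_def)
  have "lin_indep2 (axis_vec ?r) (axis_compl ?r)"
    by (simp add: lin_indep2_def axis_vec_def axis_compl_def vec4_eq_iff)
  moreover have "axis = vec.span {axis_vec ?r, axis_compl ?r}"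
  proof (intro equalityI subsetI)
    fix x :: "'a ^ 4" assume "x \<in> axis"
    from axis_decompose[OF r this] show "x \<in> vec.span {axis_vec ?r, axis_compl ?r}"
      unfolding mem_span2 by blast
  next
    fix x assume "x \<in> vec.span {axis_vec ?r, axis_compl ?r}"
    then show "x \<in> axis" by (auto simp: mem_span2 axis_eq axis_vec_def axis_compl_def)
  qed
  ultimately show ?thesis by (metis pg_line_span)
qed

text \<open>Because the line is not the axis, a second basis vector has outer coordinates that do
  not both vanish. They are cubes, hence those of a multiple of some \<open>nu z\<close>; what
  remains is an axis vector, and its \<open>axis_vec r\<close> component can be removed inside the
  line.\<close>

lemma EA_lines_eq:
  "(EA_lines :: ('a ^ 4) set set) = EA_line ` ((proj_line \<times> proj_line) \<times> (UNIV - {0}))"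
proof (intro equalityI subsetI)
  fix l :: "('a ^ 4) set" assume "l \<in> EA_lines"
  then obtain r where l: "external_line l" "l \<noteq> axis" and r: "r \<in> proj_line" and A: "axis_vec r \<in> l"
    by (auto simp: EA_lines_iff)
  have ln: "pg_line l" using l(1) by (simp add: external_line_iff)
  have ext: "nu z \<notin> l" if "z \<in> proj_line" for z
    using l(1) that by (auto simp: external_line_iff)
  obtain v where v: "lin_indep2 (axis_vec r) v" "l = vec.span {axis_vec r, v}"
    using pg_line_basis_extend[OF ln A axis_vec_nonzero[OF r]] .
  have vl: "v \<in> l" unfolding v(2) by (simp add: vec.span_base)
  have "v \<notin> axis"
  proof
    assume "v \<in> axis"
    then have "l \<subseteq> axis" unfolding v(2)
      using axis_vec_in_axis pg_line_axis by (intro vec.span_minimal) (auto simp: pg_line_def)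
    then show False using pg_line_subset_eq[OF ln pg_line_axis] l(2) by simp
  qed
  then have v0: "v $ 1 \<noteq> 0 \<or> v $ 4 \<noteq> 0" by (auto simp: axis_eq)
  obtain y1 y4 where y: "v $ 1 = y1 ^ 3" "v $ 4 = y4 ^ 3" using cube_surj by metis
  have "(y1, y4) \<noteq> (0, 0)" using v0 y by auto
  then obtain z c where z: "z \<in> proj_line" "c \<noteq> 0" "(y1, y4) = (c * fst z, c * snd z)"
    by (rule proj_line_representative)
  have "v - c ^ 3 *s nu z \<in> axis" using y z(3) by (simp add: axis_eq nu_def power_mult_distrib)
  then obtain a b where ab: "v - c ^ 3 *s nu z = a *s axis_vec r + b *s axis_compl r"
    using axis_decompose[OF r] by blast
  define k where "k = b / c ^ 3"
  have ve: "v - a *s axis_vec r = c ^ 3 *s (nu z + k *s axis_compl r)"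
    using ab z(2) by (simp add: k_def vec.scale_right_distrib algebra_simps)
  have "(1 / c ^ 3) *s v + (- (a / c ^ 3)) *s axis_vec r \<in> l" by (rule pg_line_comb[OF ln vl A])
  also have "(1 / c ^ 3) *s v + (- (a / c ^ 3)) *s axis_vec r = (1 / c ^ 3) *s (v - a *s axis_vec r)"
    by (simp add: vec.scale_right_diff_distrib)
  also have "\<dots> = nu z + k *s axis_compl r" unfolding ve using z(2) by simp
  finally have u: "nu z + k *s axis_compl r \<in> l" .
  have "k \<noteq> 0" using u ext[OF z(1)] by auto
  moreover have "l = EA_line ((r, z), k)" unfolding EA_line_def
    using pg_line_eq_span[OF ln A u lin_indep3_comb[OF lin_indep3_axis_nu_compl[OF r z(1)]]] by simp
  ultimately show "l \<in> EA_line ` ((proj_line \<times> proj_line) \<times> (UNIV - {0}))"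
    using r z(1) by auto
next
  fix l :: "('a ^ 4) set" assume "l \<in> EA_line ` ((proj_line \<times> proj_line) \<times> (UNIV - {0}))"
  then obtain x where x: "x \<in> (proj_line \<times> proj_line) \<times> (UNIV - {0})" "l = EA_line x" by blast
  obtain r z k where "x = ((r, z), k)" by (metis prod.exhaust)
  with x have r: "r \<in> proj_line" and z: "z \<in> proj_line" and k: "k \<noteq> 0"
    and l: "l = vec.span {axis_vec r, nu z + k *s axis_compl r}"
    by (auto simp: EA_line_def)
  note i = lin_indep3_axis_nu_compl[OF r z]
  have ln: "pg_line l" unfolding l by (rule pg_line_span[OF lin_indep3_comb[OF i]])
  have "nu w \<notin> l" if w: "w \<in> proj_line" for w
  proof
    assume "nu w \<in> l"
    then obtain x y where e: "nu w = x *s axis_vec r + y *s (nu z + k *s axis_compl r)"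
      unfolding l by (auto simp: mem_span2)
    then have "fst w ^ 3 = y * fst z ^ 3" "snd w ^ 3 = y * snd z ^ 3"
      by (auto simp: vec4_eq_iff axis_vec_def axis_compl_def nu_def)
    then have "w = z" using proj_line_cube_eq[OF z w] by blast
    then have "0 *s axis_vec r + 1 *s nu z + 0 *s axis_compl r =
        x *s axis_vec r + y *s nu z + (y * k) *s axis_compl r"
      using e by (simp add: vec.scale_right_distrib add.assoc)
    then show False using lin_indep3_eqD[OF i] k by fastforce
  qed
  moreover have "l \<noteq> axis"
  proof
    assume "l = axis"
    then have "nu z + k *s axis_compl r \<in> axis" unfolding l by (metis insertCI vec.span_base)
    then have "fst z ^ 3 = 0" "snd z ^ 3 = 0" by (auto simp: axis_eq nu_def axis_compl_def)
    then show False using proj_line_nonzero[OF z] by auto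
  qed
  moreover have "axis_vec r \<in> l" unfolding l by (simp add: vec.span_base)
  ultimately show "l \<in> EA_lines" using ln r by (auto simp: EA_lines_iff external_line_iff)
qed

text \<open>The parameters are recovered one after another: \<open>r\<close> from the intersection
  with the axis, \<open>z\<close> from the outer coordinates, \<open>k\<close> from
  independence.\<close>

lemma inj_on_EA_line:
  "inj_on EA_line ((proj_line \<times> proj_line) \<times> (UNIV - {0 :: 'a}))"
proof (rule inj_onI)
  fix u u' :: "(('a \<times> 'a) \<times> ('a \<times> 'a)) \<times> 'a"
  assume u: "u \<in> (proj_line \<times> proj_line) \<times> (UNIV - {0})" "u' \<in> (proj_line \<times> proj_line) \<times> (UNIV - {0})"
    and e: "EA_line u = EA_line u'"
  obtain r z k r' z' k' where rzk: "u = ((r, z), k)" "u' = ((r', z'), k')" by (metis prod.exhaust)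
  have P: "r \<in> proj_line" "z \<in> proj_line" "r' \<in> proj_line" "z' \<in> proj_line"
    using u rzk by auto
  have "EA_line ((r, z), k) = EA_line ((r', z'), k')" using e rzk by simp
  then have "vec.span {axis_vec r, nu z + k *s axis_compl r}
      = vec.span {axis_vec r', nu z' + k' *s axis_compl r'}"
    by (simp add: EA_line_def)
  then have m: "axis_vec r' \<in> vec.span {axis_vec r, nu z + k *s axis_compl r}"
    "nu z' + k' *s axis_compl r' \<in> vec.span {axis_vec r, nu z + k *s axis_compl r}"
    by (metis insertCI vec.span_base)+
  from m(1) obtain x y where e: "axis_vec r' = x *s axis_vec r + y *s (nu z + k *s axis_compl r)"
    by (auto simp: mem_span2)
  then have "y * fst z ^ 3 = 0" "y * snd z ^ 3 = 0"
    by (auto simp: vec4_eq_iff axis_vec_def axis_compl_def nu_def)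
  then have "y = 0" using proj_line_nonzero[OF P(2)] by auto
  then have r: "r' = r" using e P(1,3)
    by (auto simp: vec4_eq_iff axis_vec_def proj_line_def)
  from m(2) obtain x y where e: "nu z' + k' *s axis_compl r = x *s axis_vec r + y *s (nu z + k *s axis_compl r)"
    unfolding r by (auto simp: mem_span2)
  then have "fst z' ^ 3 = y * fst z ^ 3" "snd z' ^ 3 = y * snd z ^ 3"
    by (auto simp: vec4_eq_iff axis_vec_def axis_compl_def nu_def)
  then have z: "z' = z" using proj_line_cube_eq[OF P(2,4)] by blast
  then have "0 *s axis_vec r + 1 *s nu z + k' *s axis_compl r =
      x *s axis_vec r + y *s nu z + (y * k) *s axis_compl r"
    using e by (simp add: vec.scale_right_distrib add.assoc)
  then have "k = k'" using lin_indep3_eqD[OF lin_indep3_axis_nu_compl[OF P(1,2)]] by fastforce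
  with r z show "u = u'" by (simp add: rzk)
qed

lemma card_EA_lines:
  "card (EA_lines :: ('a ^ 4) set set) = (CARD('a) + 1) ^ 2 * (CARD('a) - 1)"
  unfolding EA_lines_eq
  by (simp add: card_image[OF inj_on_EA_line] card_cartesian_product card_proj_line
      card_Diff_singleton power2_eq_square)

end

section \<open>Lines skew to the axis\<close>

text \<open>Inclusion--exclusion in the situation where no \<open>x\<close> is incident with more than two points:
  \<open>2 [n = 0] = 2 - 3 n + n\<^sup>2\<close> for \<open>n \<le> 2\<close>.\<close>

lemma card_not_incident:
  fixes R :: "'x \<Rightarrow> 'y \<Rightarrow> bool"
  assumes fin: "finite S" "finite Y"
    and one: "\<And>y. y \<in> Y \<Longrightarrow> card {x \<in> S. R x y} = d"
    and two: "\<And>y z. y \<in> Y \<Longrightarrow> z \<in> Y \<Longrightarrow> y \<noteq> z \<Longrightarrow> card {x \<in> S. R x y \<and> R x z} = 1"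
    and le2: "\<And>x. x \<in> S \<Longrightarrow> card {y \<in> Y. R x y} \<le> 2"
  shows "2 * int (card {x \<in> S. \<forall>y \<in> Y. \<not> R x y}) =
    2 * int (card S) - 2 * int (card Y) * int d + int (card Y) * (int (card Y) - 1)"
proof -
  let ?n = "\<lambda>x. \<Sum>y\<in>Y. of_bool (R x y) :: int"
  have n: "?n x = int (card {y \<in> Y. R x y})" for x
    using fin by (simp add: of_bool_def sum.If_cases Int_def)
  have pt: "2 * of_bool (\<forall>y \<in> Y. \<not> R x y) = 2 - 3 * ?n x + ?n x * ?n x" if "x \<in> S" for x
  proof -
    have "card {y \<in> Y. R x y} = 0 \<or> card {y \<in> Y. R x y} = 1 \<or> card {y \<in> Y. R x y} = 2"
      using le2[OF that] by linarith
    moreover have "card {y \<in> Y. R x y} = 0 \<longleftrightarrow> (\<forall>y \<in> Y. \<not> R x y)" using fin by auto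
    ultimately show ?thesis unfolding n by (elim disjE) auto
  qed
  have c: "(\<Sum>x\<in>S. of_bool (P x)) = int (card {x \<in> S. P x})" for P
    using fin by (simp add: of_bool_def sum.If_cases Int_def)
  have s1: "(\<Sum>x\<in>S. ?n x) = int (card Y) * int d"
  proof -
    have "(\<Sum>x\<in>S. ?n x) = (\<Sum>y\<in>Y. \<Sum>x\<in>S. of_bool (R x y))" by (rule sum.swap)
    also have "\<dots> = (\<Sum>y\<in>Y. int d)" by (rule sum.cong) (simp_all add: c one)
    finally show ?thesis by simp
  qed
  \<comment> \<open>The square of the incidence number counts ordered pairs: the diagonal one
    contributes \<open>d\<close>, each of the others 1.\<close>
  have inner: "(\<Sum>z\<in>Y. int (card {x \<in> S. R x y \<and> R x z})) = int d + (int (card Y) - 1)" if y: "y \<in> Y" for y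
  proof -
    have "(\<Sum>z\<in>Y. int (card {x \<in> S. R x y \<and> R x z}))
        = int (card {x \<in> S. R x y \<and> R x y}) + (\<Sum>z\<in>Y - {y}. int (card {x \<in> S. R x y \<and> R x z}))"
      by (rule sum.remove[OF fin(2) y])
    also have "(\<Sum>z\<in>Y - {y}. int (card {x \<in> S. R x y \<and> R x z})) = (\<Sum>z\<in>Y - {y}. 1)"
      using two[OF y] by (intro sum.cong) auto
    also have "\<dots> = int (card Y) - 1"
      using y fin by (simp add: card_Diff_singleton card_gt_0_iff of_nat_diff Suc_leI)
        (metis One_nat_def Suc_leI card_gt_0_iff empty_iff of_nat_1 of_nat_diff)
    finally show ?thesis using one[OF y] by simp
  qed
  have s2: "(\<Sum>x\<in>S. ?n x * ?n x) = int (card Y) * (int d + (int (card Y) - 1))"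
  proof -
    have "(\<Sum>x\<in>S. ?n x * ?n x) = (\<Sum>x\<in>S. \<Sum>y\<in>Y. \<Sum>z\<in>Y. of_bool (R x y \<and> R x z))"
      by (simp add: sum_product of_bool_conj)
    also have "\<dots> = (\<Sum>y\<in>Y. \<Sum>x\<in>S. \<Sum>z\<in>Y. of_bool (R x y \<and> R x z))" by (rule sum.swap)
    also have "\<dots> = (\<Sum>y\<in>Y. \<Sum>z\<in>Y. \<Sum>x\<in>S. of_bool (R x y \<and> R x z))"
      by (rule sum.cong[OF refl]) (rule sum.swap)
    also have "\<dots> = (\<Sum>y\<in>Y. int d + (int (card Y) - 1))"
      unfolding c by (rule sum.cong[OF refl]) (rule inner)
    finally show ?thesis by simp
  qed
  have "2 * int (card {x \<in> S. \<forall>y \<in> Y. \<not> R x y}) = (\<Sum>x\<in>S. 2 * of_bool (\<forall>y \<in> Y. \<not> R x y))"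
    unfolding c[symmetric] by (simp only: sum_distrib_left)
  also have "\<dots> = (\<Sum>x\<in>S. 2 - 3 * ?n x + ?n x * ?n x)" by (rule sum.cong[OF refl]) (rule pt)
  also have "\<dots> = 2 * int (card S) - 3 * (\<Sum>x\<in>S. ?n x) + (\<Sum>x\<in>S. ?n x * ?n x)"
    by (simp only: sum.distrib sum_subtractf sum_distrib_left[symmetric] sum_constant mult.commute[of _ 2])
  finally show ?thesis unfolding s1 s2 by (simp add: algebra_simps)
qed

lemma card_eq_1_if_ex1:
  assumes "\<exists>!x. P x"
  shows "card {x. P x} = 1"
proof -
  obtain y where "P y" "\<And>x. P x \<Longrightarrow> x = y" using assms by blast
  then have "{x. P x} = {y}" by blast
  then show ?thesis by simp
qed

lemma avg_planes_through_eq: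
  fixes Pl L :: "('a::{field,finite} ^ 4) set set"
  assumes "\<And>E. E \<in> Pl \<Longrightarrow> num_lines_in L E = n"
  shows "avg_planes_through Pl L = real (card Pl) * real n / real (card L)"
proof -
  have "(\<Sum>l\<in>L. card {E \<in> Pl. l \<subseteq> E}) = (\<Sum>E\<in>Pl. n)"
    by (rule sum_multicount_gen) (use assms in \<open>auto simp: num_lines_in_def\<close>)
  then have "(\<Sum>l\<in>L. real (card {E \<in> Pl. l \<subseteq> E})) = real (card Pl) * real n"
    by (simp flip: of_nat_sum of_nat_mult)
  then show ?thesis by (simp add: avg_planes_through_def)
qed

definition skew_to_axis :: "('a::field ^ 4) set \<Rightarrow> bool" where
  "skew_to_axis l \<longleftrightarrow> l \<inter> axis = {0}"

text \<open>The graph of a linear map from the outer to the inner coordinates; complements of the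
  axis are exactly such graphs. Grouping the matrix by rows lets incidence with a cubic point split
  into one condition on \<open>(a, b)\<close> and one on \<open>(c, d)\<close>.\<close>

definition graph_line :: "('a::field \<times> 'a) \<times> ('a \<times> 'a) \<Rightarrow> ('a ^ 4) set" where
  "graph_line = (\<lambda>((a, b), (c, d)). {x. x $ 2 = a * x $ 1 + b * x $ 4 \<and> x $ 3 = c * x $ 1 + d * x $ 4})"

lemma graph_line_eq_span:
  "graph_line ((a, b), (c, d)) = vec.span {vector [1, a, c, 0], vector [0, b, d, 1 :: 'a::field]}"
proof (intro equalityI subsetI)
  fix x :: "'a ^ 4" assume "x \<in> graph_line ((a, b), (c, d))"
  then have "x = (x $ 1) *s vector [1, a, c, 0] + (x $ 4) *s vector [0, b, d, 1]"
    by (simp add: graph_line_def vec4_eq_iff mult.commute)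
  then show "x \<in> vec.span {vector [1, a, c, 0], vector [0, b, d, 1]}" unfolding mem_span2 by blast
qed (auto simp: mem_span2 graph_line_def mult.commute)

lemma pg_line_graph_line: "pg_line (graph_line g)"
proof -
  obtain a b c d where g: "g = ((a, b), (c, d))" by (metis prod.exhaust)
  show ?thesis unfolding g graph_line_eq_span
    by (rule pg_line_span) (auto simp: lin_indep2_def vec4_eq_iff)
qed

lemma inj_graph_line: "inj (graph_line :: ('a::field \<times> 'a) \<times> ('a \<times> 'a) \<Rightarrow> ('a ^ 4) set)"
proof (rule injI)
  fix g g' :: "('a \<times> 'a) \<times> ('a \<times> 'a)" assume e: "graph_line g = graph_line g'"
  obtain a b c d where g: "g = ((a, b), (c, d))" by (metis prod.exhaust)
  obtain a' b' c' d' where g': "g' = ((a', b'), (c', d'))" by (metis prod.exhaust)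
  have "vector [1, a, c, 0] \<in> graph_line g'" "vector [0, b, d, 1] \<in> graph_line g'"
    unfolding e[symmetric] by (simp_all add: g graph_line_def)
  then show "g = g'" by (simp add: g g' graph_line_def)
qed

lemma nu_mem_graph_line_iff:
  "nu z \<in> graph_line ((a, b), (c, d)) \<longleftrightarrow>
    fst z ^ 3 * a + snd z ^ 3 * b = fst z ^ 2 * snd z \<and>
    fst z ^ 3 * c + snd z ^ 3 * d = fst z * snd z ^ (2 :: nat)"
  by (auto simp: graph_line_def nu_def mult.commute)

lemma card_affine_line:
  fixes z :: "'a::{field,finite} \<times> 'a"
  assumes "z \<in> proj_line"
  shows "card {ab :: 'a \<times> 'a. fst z ^ 3 * fst ab + snd z ^ 3 * snd ab = e} = CARD('a)"
proof (cases "snd z = 0")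
  case True
  then have "{ab :: 'a \<times> 'a. fst z ^ 3 * fst ab + snd z ^ 3 * snd ab = e} = range (\<lambda>b. (e, b))"
    using assms by (auto simp: proj_line_def)
  then show ?thesis by (simp add: card_image inj_on_def)
next
  case False
  then have "{ab :: 'a \<times> 'a. fst z ^ 3 * fst ab + snd z ^ 3 * snd ab = e}
      = range (\<lambda>a. (a, e - fst z ^ 3 * a))"
    using assms by (auto simp: proj_line_def image_def algebra_simps)
  then show ?thesis by (simp add: card_image inj_on_def)
qed

context char3_field
begin

lemma skew_to_axis_iff:
  assumes "pg_line l"
  shows "skew_to_axis l \<longleftrightarrow> (\<forall>x \<in> l. x $ 1 = 0 \<and> x $ 4 = (0 :: 'a) \<longrightarrow> x = 0)"
proof -
  have "0 \<in> l" using assms by (simp add: pg_line_def vec.subspace_0)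
  then show ?thesis by (auto simp: skew_to_axis_def axis_eq)
qed

lemma skew_det:
  assumes "pg_line l" "skew_to_axis l" "u \<in> l" "v \<in> l" "lin_indep2 u (v :: 'a ^ 4)"
  shows "u $ 1 * v $ 4 - v $ 1 * u $ 4 \<noteq> 0"
proof
  assume d: "u $ 1 * v $ 4 - v $ 1 * u $ 4 = 0"
  have sk: "a = 0 \<and> b = 0" if "(a *s u + b *s v) $ 1 = 0" "(a *s u + b *s v) $ 4 = 0" for a b
  proof -
    have "a *s u + b *s v \<in> l" by (rule pg_line_comb[OF assms(1,3,4)])
    then have "a *s u + b *s v = 0" using assms(2) that unfolding skew_to_axis_iff[OF assms(1)] by blast
    then show ?thesis using assms(5) unfolding lin_indep2_def by blast
  qed
  \<comment> \<open>The combination \<open>v $ 4\<close>, \<open>- u $ 4\<close> kills the last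
    coordinate identically and the first one by \<open>d\<close>; the next line exchanges the roles
    of the two coordinates.\<close>
  have "v $ 4 = 0 \<and> - u $ 4 = 0" by (rule sk) (use d in \<open>simp_all add: algebra_simps\<close>)
  moreover have "v $ 1 = 0 \<and> - u $ 1 = 0" by (rule sk) (use d in \<open>simp_all add: algebra_simps\<close>)
  ultimately have "(1 :: 'a) = 0 \<and> (0 :: 'a) = 0" by (intro sk) simp_all
  then show False by simp
qed

text \<open>Projection from the axis restricts to an isomorphism from a skew line onto the outer
  coordinates, so a vector of the line can be chosen by prescribing them.\<close>

lemma skew_section:
  assumes "pg_line l" "skew_to_axis l"
  obtains x where "x \<in> l" "x $ 1 = y" "x $ 4 = (w :: 'a)"
proof -
  obtain u v where uv: "lin_indep2 u v" "l = vec.span {u, v}" using pg_line_basis[OF assms(1)] .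
  have m: "u \<in> l" "v \<in> l" unfolding uv(2) by (simp_all add: vec.span_base)
  have "u $ 1 * v $ 4 - v $ 1 * u $ 4 \<noteq> 0" by (rule skew_det[OF assms m uv(1)])
  from solve_2x2[OF this, of y w] obtain a b where
    "u $ 1 * a + v $ 1 * b = y" "u $ 4 * a + v $ 4 * b = w" by auto
  then show ?thesis using that[OF pg_line_comb[OF assms(1) m, of a b]] by (simp add: mult.commute)
qed

lemma no_Gamma_plane_iff_skew:
  assumes "pg_line l"
  shows "(\<forall>E \<in> Gamma_planes. \<not> l \<subseteq> E) \<longleftrightarrow> skew_to_axis (l :: ('a ^ 4) set)"
proof
  assume G: "\<forall>E \<in> Gamma_planes. \<not> l \<subseteq> E"
  show "skew_to_axis l"
    unfolding skew_to_axis_iff[OF assms]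
  proof (intro ballI impI, rule ccontr)
    fix x assume x: "x \<in> l" "x $ 1 = 0 \<and> x $ 4 = 0" "x \<noteq> 0"
    obtain v where v: "lin_indep2 x v" "l = vec.span {x, v}"
      using pg_line_basis_extend[OF assms x(1,3)] .
    have "\<exists>E \<in> Gamma_planes. l \<subseteq> E"
    proof (cases "v $ 4 = 0")
      case True
      then have "l \<subseteq> plane_of 0 0 0 1" using x unfolding v(2) by (auto simp: mem_span2 plane_of_def)
      then show ?thesis by (auto simp: Gamma_planes_def)
    next
      case False
      \<comment> \<open>Surjectivity of cubing is what makes the \<Gamma>-planes exhaust the planes
        through the axis.\<close>
      obtain t where "v $ 1 / v $ 4 = t ^ 3" using cube_surj .
      then have "v $ 1 = t ^ 3 * v $ 4" using False by (simp add: field_simps)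
      then have "l \<subseteq> plane_of 1 (- 3 * t) (3 * t ^ 2) (- (t ^ 3))" using x
        unfolding v(2) Gamma_plane_eq by (auto simp: mem_span2)
      then show ?thesis unfolding Gamma_planes_def by blast
    qed
    with G show False by blast
  qed
next
  assume s: "skew_to_axis l"
  show "\<forall>E \<in> Gamma_planes. \<not> l \<subseteq> E"
  proof
    fix E :: "('a ^ 4) set" assume "E \<in> Gamma_planes"
    then consider "E = plane_of 0 0 0 1" | t where "E = {x. x $ 1 = t ^ 3 * x $ 4}"
      by (auto simp: Gamma_planes_def Gamma_plane_eq[simplified])
    then show "\<not> l \<subseteq> E"
    proof cases
      case 1
      obtain x where "x \<in> l" "x $ 1 = 0" "x $ 4 = 1" using skew_section[OF assms s] .
      then show ?thesis unfolding 1 by (auto simp: plane_of_def)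
    next
      case 2
      obtain x where "x \<in> l" "x $ 1 = 1" "x $ 4 = 0" using skew_section[OF assms s] .
      then show ?thesis unfolding 2 by auto
    qed
  qed
qed

lemma EnGamma_lines_iff:
  "l \<in> EnGamma_lines \<longleftrightarrow> external_line l \<and> skew_to_axis l \<and> \<not> imaginary_chord (l :: ('a ^ 4) set)"
  using no_Gamma_plane_iff_skew[of l] by (auto simp: EnGamma_lines_def external_line_iff)

lemma skew_graph_line: "skew_to_axis (graph_line (g :: ('a \<times> 'a) \<times> ('a \<times> 'a)))"
  unfolding skew_to_axis_iff[OF pg_line_graph_line] by (auto simp: graph_line_def vec4_eq_iff)

text \<open>The vectors of the line over the outer coordinates \<open>(1, 0)\<close> and
  \<open>(0, 1)\<close> form the reduced basis from which the matrix is read off.\<close>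

lemma skew_lines_eq:
  "{l. pg_line l \<and> skew_to_axis l} = range (graph_line :: ('a \<times> 'a) \<times> ('a \<times> 'a) \<Rightarrow> ('a ^ 4) set)"
proof (intro equalityI subsetI)
  fix l :: "('a ^ 4) set" assume "l \<in> {l. pg_line l \<and> skew_to_axis l}"
  then have l: "pg_line l" "skew_to_axis l" by auto
  obtain u where u: "u \<in> l" "u $ 1 = 1" "u $ 4 = 0" using skew_section[OF l] .
  obtain v where v: "v \<in> l" "v $ 1 = 0" "v $ 4 = 1" using skew_section[OF l] .
  have "u = vector [1, u $ 2, u $ 3, 0]" "v = vector [0, v $ 2, v $ 3, 1]"
    using u v by (simp_all add: vec4_eq_iff)
  moreover have "lin_indep2 u v" using u v by (auto simp: lin_indep2_def vec4_eq_iff)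
  then have "l = vec.span {u, v}" using pg_line_eq_span[OF l(1)] u v by blast
  ultimately have "l = graph_line ((u $ 2, v $ 2), (u $ 3, v $ 3))"
    unfolding graph_line_eq_span by metis
  then show "l \<in> range graph_line" by blast
qed (auto simp: pg_line_graph_line skew_graph_line)

text \<open>No three points of the cubic are collinear. For any \<open>n\<close> other than
  \<open>z\<close>, the plane with roots \<open>p\<close>, \<open>m\<close>, \<open>n\<close>
  contains the secant, so \<open>z\<close> is one of its roots and cannot be
  \<open>n\<close>.\<close>

lemma secant_line_points:
  assumes "pg_line l" "nu p \<in> l" "nu m \<in> l" "nu z \<in> l"
    and "p \<in> proj_line" "m \<in> proj_line" "z \<in> proj_line" "p \<noteq> (m :: 'a \<times> 'a)"
  shows "z = p \<or> z = m"
proof -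
  have "lin_indep2 (nu p) (nu m)"
    using lin_indep3_axis_nu_nu[OF assms(5,5,6,8)] by (simp add: lin_indep3_iff)
  then have l: "l = vec.span {nu p, nu m}" using pg_line_eq_span assms by blast
  have "\<not> proj_line \<subseteq> {z}"
  proof
    assume "proj_line \<subseteq> {z}"
    then have "card (proj_line :: ('a \<times> 'a) set) \<le> card {z}" by (intro card_mono) auto
    then show False using card_field_ge_3 by (simp add: card_proj_line)
  qed
  then obtain n where n: "n \<in> proj_line" "n \<noteq> z" by blast
  have "l \<subseteq> cubic_plane p m n" unfolding l
    by (intro vec.span_minimal subspace_cubic_plane) (auto simp: nu_mem_cubic_plane cross_def)
  then have "nu z \<in> cubic_plane p m n" using assms(4) by blast
  then show ?thesis using n assms by (auto simp: nu_mem_cubic_plane cross_eq_0_iff)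
qed

text \<open>Each cubic point lies on \<open>q ^ 2\<close> graph lines, because incidence is one
  affine equation for each row of the matrix; two points determine both rows, and no line carries
  three.\<close>

lemma card_skew_external:
  "2 * int (card {l :: ('a ^ 4) set. external_line l \<and> skew_to_axis l}) =
    2 * int CARD('a) ^ 4 - 2 * (int CARD('a) + 1) * int CARD('a) ^ 2
      + (int CARD('a) + 1) * int CARD('a)"
proof -
  let ?R = "\<lambda>(g :: ('a \<times> 'a) \<times> ('a \<times> 'a)) z. nu z \<in> graph_line g"
  have eq: "{g. ?R g z} = {ab. fst z ^ 3 * fst ab + snd z ^ 3 * snd ab = fst z ^ 2 * snd z}
      \<times> {cd. fst z ^ 3 * fst cd + snd z ^ 3 * snd cd = fst z * snd z ^ 2}" for z
    by (auto simp: nu_mem_graph_line_iff)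
  have "2 * int (card {g \<in> UNIV. \<forall>z \<in> proj_line. \<not> ?R g z}) =
      2 * int (card (UNIV :: (('a \<times> 'a) \<times> ('a \<times> 'a)) set))
      - 2 * int (card (proj_line :: ('a \<times> 'a) set)) * int (CARD('a) ^ 2)
      + int (card (proj_line :: ('a \<times> 'a) set)) * (int (card (proj_line :: ('a \<times> 'a) set)) - 1)"
  proof (rule card_not_incident)
    fix z :: "'a \<times> 'a" assume z: "z \<in> proj_line"
    show "card {g \<in> UNIV. ?R g z} = CARD('a) ^ 2"
      using eq[of z] by (simp add: card_cartesian_product card_affine_line[OF z] power2_eq_square)
  next
    fix z w :: "'a \<times> 'a" assume zw: "z \<in> proj_line" "w \<in> proj_line" "z \<noteq> w"
    have det: "fst z ^ 3 * snd w ^ 3 - snd z ^ 3 * fst w ^ 3 \<noteq> 0"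
      using zw by (simp add: cross_cube cross_eq_0_iff)
    have "{g \<in> UNIV. ?R g z \<and> ?R g w} =
      {xy. fst z ^ 3 * fst xy + snd z ^ 3 * snd xy = fst z ^ 2 * snd z \<and>
        fst w ^ 3 * fst xy + snd w ^ 3 * snd xy = fst w ^ 2 * snd w} \<times>
      {xy. fst z ^ 3 * fst xy + snd z ^ 3 * snd xy = fst z * snd z ^ 2 \<and>
        fst w ^ 3 * fst xy + snd w ^ 3 * snd xy = fst w * snd w ^ 2}"
      by (auto simp: nu_mem_graph_line_iff)
    then show "card {g \<in> UNIV. ?R g z \<and> ?R g w} = 1"
      by (simp add: card_cartesian_product card_eq_1_if_ex1[OF solve_2x2[OF det]])
  next
    fix g :: "('a \<times> 'a) \<times> ('a \<times> 'a)"
    show "card {z \<in> proj_line. ?R g z} \<le> 2"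
    proof (cases "\<exists>p m. p \<in> proj_line \<and> m \<in> proj_line \<and> p \<noteq> m \<and> ?R g p \<and> ?R g m")
      case True
      then obtain p m where pm: "p \<in> proj_line" "m \<in> proj_line" "p \<noteq> m" "?R g p" "?R g m" by blast
      have "{z \<in> proj_line. ?R g z} \<subseteq> {p, m}"
        using secant_line_points[OF pg_line_graph_line pm(4,5) _ pm(1,2) _ pm(3)] by blast
      then have "card {z \<in> proj_line. ?R g z} \<le> card {p, m}" by (intro card_mono) auto
      then show ?thesis using pm(3) by simp
    next
      case False
      then have "card {z \<in> proj_line. ?R g z} \<le> 1" by (auto simp: card_le_Suc0_iff_eq)
      then show ?thesis by simp
    qed
  qed simp_all
  moreover have "{l :: ('a ^ 4) set. external_line l \<and> skew_to_axis l} =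
      graph_line ` {g \<in> UNIV. \<forall>z \<in> proj_line. \<not> ?R g z}"
  proof (intro equalityI subsetI)
    fix l :: "('a ^ 4) set" assume "l \<in> {l. external_line l \<and> skew_to_axis l}"
    then have l: "external_line l" "l \<in> {l. pg_line l \<and> skew_to_axis l}"
      by (auto simp: external_line_iff)
    then obtain g where "l = graph_line g" unfolding skew_lines_eq by blast
    with l(1) show "l \<in> graph_line ` {g \<in> UNIV. \<forall>z \<in> proj_line. \<not> ?R g z}"
      by (simp add: external_line_iff)
  qed (auto simp: external_line_iff pg_line_graph_line skew_graph_line)
  moreover have "card (graph_line ` {g \<in> UNIV. \<forall>z \<in> proj_line. \<not> ?R g z}) =
      card {g \<in> UNIV. \<forall>z \<in> proj_line. \<not> ?R g z}"
    by (rule card_image) (rule inj_on_subset[OF inj_graph_line], simp)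
  ultimately show ?thesis
    by (simp add: card_proj_line power4_eq_xxxx power2_eq_square algebra_simps)
qed

end

section \<open>Imaginary chords\<close>

text \<open>The chord joining the points with parameters the two, possibly conjugate, roots of \<open>t\<^sup>2 - s t + d\<close>.\<close>

definition quad_line :: "'a::field \<times> 'a \<Rightarrow> ('a ^ 4) set" where
  "quad_line = (\<lambda>(s, d). {x. x $ 1 = s * x $ 2 - d * x $ 3 \<and> x $ 2 = s * x $ 3 - d * x $ 4})"

text \<open>The pair holds the sum and the product of the two conjugate roots. In degree two,
  irreducibility is the absence of a root.\<close>

definition irreducible_quadratics :: "('a::field \<times> 'a) set" where
  "irreducible_quadratics = {(s, d). \<forall>t. t ^ 2 - s * t + d \<noteq> 0}"

lemma quad_line_eq_span:
  "quad_line (s, d) = vec.span {vector [s ^ 2 - d, s, 1, 0], vector [- (s * d), - d, 0, 1]}"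
proof (intro equalityI subsetI)
  fix x assume "x \<in> quad_line (s, d)"
  then have "x $ 1 = s * x $ 2 - d * x $ 3" "x $ 2 = s * x $ 3 - d * x $ 4"
    by (simp_all add: quad_line_def)
  then have "x = (x $ 3) *s vector [s ^ 2 - d, s, 1, 0] + (x $ 4) *s vector [- (s * d), - d, 0, 1]"
    by (simp add: vec4_eq_iff algebra_simps power2_eq_square)
  then show "x \<in> vec.span {vector [s ^ 2 - d, s, 1, 0], vector [- (s * d), - d, 0, 1]}"
    unfolding mem_span2 by blast
qed (auto simp: mem_span2 quad_line_def algebra_simps power2_eq_square)

lemma pg_line_quad_line: "pg_line (quad_line sd)"
proof (cases sd)
  case (Pair s d)
  show ?thesis unfolding Pair quad_line_eq_span
    by (rule pg_line_span) (auto simp: lin_indep2_def vec4_eq_iff)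
qed

text \<open>The equations of \<open>quad_line\<close> are a linear recurrence along the coordinates,
  with characteristic roots \<open>u\<close> and \<open>v\<close>. Its solutions are spanned by the
  two geometric progressions, which are the cubic points. This holds over any field, in particular
  over the algebraic closure.\<close>

lemma quad_line_eq_chord:
  assumes "u \<noteq> v"
  shows "quad_line (u + v, u * v) = vec.span {cubic_vec u, cubic_vec v}"
proof (rule pg_line_eq_span[OF pg_line_quad_line])
  show "lin_indep2 (cubic_vec u) (cubic_vec v)"
    unfolding lin_indep2_def
  proof (intro allI impI)
    fix a b assume "a *s cubic_vec u + b *s cubic_vec v = 0"
    then have "a * u + b * v = 0" "a * 1 + b * 1 = 0"
      by (auto simp: vec4_eq_iff cubic_vec_def)
    then show "a = 0 \<and> b = 0" by (rule det_nonzero_imp_zero) (use assms in simp)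
  qed
qed (simp_all add: quad_line_def cubic_vec_def algebra_simps power2_eq_square power3_eq_cube)

lemma extend_vec_mem_quad_line:
  "extend_vec x \<in> quad_line (to_ac s, to_ac d) \<longleftrightarrow> x \<in> quad_line (s, d)"
  unfolding quad_line_def extend_vec_def
  by (simp flip: to_ac_mult to_ac_diff)

text \<open>The basis of \<open>quad_line\<close> is polynomial in \<open>s\<close> and
  \<open>d\<close>, so extending scalars merely replaces these by their images.\<close>

lemma span_extend_quad_line:
  "vec.span (extend_vec ` quad_line (s, d)) = quad_line (to_ac s, to_ac d)"
proof
  show "vec.span (extend_vec ` quad_line (s, d)) \<subseteq> quad_line (to_ac s, to_ac d)"
    using pg_line_quad_line by (intro vec.span_minimal) (auto simp: extend_vec_mem_quad_line pg_line_def)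
  have e: "vector [to_ac s ^ 2 - to_ac d, to_ac s, 1, 0] = extend_vec (vector [s ^ 2 - d, s, 1, 0])"
    "vector [- (to_ac s * to_ac d), - to_ac d, 0, 1] = extend_vec (vector [- (s * d), - d, 0, 1])"
    by (simp_all add: vec4_eq_iff extend_vec_def)
  have "vector [s ^ 2 - d, s, 1, 0] \<in> quad_line (s, d)"
    "vector [- (s * d), - d, 0, 1] \<in> quad_line (s, d)"
    unfolding quad_line_eq_span by (simp_all add: vec.span_base)
  then show "quad_line (to_ac s, to_ac d) \<subseteq> vec.span (extend_vec ` quad_line (s, d))"
    unfolding quad_line_eq_span[of "to_ac s"] e by (intro vec.span_mono) auto
qed

lemma inj_quad_line: "inj quad_line"
proof (rule injI, clarify)
  fix s d s' d' :: 'a assume e: "quad_line (s, d) = quad_line (s', d')"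
  have "vector [s ^ 2 - d, s, 1, 0] \<in> quad_line (s', d')" "vector [- (s * d), - d, 0, 1] \<in> quad_line (s', d')"
    unfolding e[symmetric] unfolding quad_line_eq_span by (simp_all add: vec.span_base)
  then show "s = s' \<and> d = d'" by (auto simp: quad_line_def)
qed

section \<open>The Frobenius map and conjugate parameters\<close>

lemma power_card_field: "x ^ CARD('a) = (x :: 'a::{field,finite})"
proof (cases "x = 0")
  case False
  let ?U = "UNIV - {0 :: 'a}"
  \<comment> \<open>Multiplication by \<open>x\<close> permutes the nonzero elements, so their
    product absorbs one factor \<open>x\<close> for each of them.\<close>
  have "(\<Prod>y\<in>?U. x * y) = \<Prod>?U"
    by (rule prod.reindex_bij_witness[of _ "\<lambda>y. y / x" "\<lambda>y. x * y"]) (use False in auto)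
  then have "x ^ card ?U * \<Prod>?U = \<Prod>?U" by (simp add: prod.distrib)
  then have "x ^ card ?U = 1" by simp
  then have "x ^ Suc (card ?U) = x" by (simp only: power_Suc mult_1_right)
  also have "Suc (card ?U) = CARD('a)" by (rule card_Suc_Diff1) auto
  finally show ?thesis .
qed simp

context char3_field
begin

text \<open>Iterated additivity of cubing. The field \<open>'b\<close> is kept separate from
  \<open>'a\<close>, so that the exponent comes from the ground field while the elements lie in its
  algebraic closure.\<close>

lemma add_power_card:
  fixes x y :: "'b::field"
  assumes "(3 :: 'b) = 0"
  shows "(x + y) ^ CARD('a) = x ^ CARD('a) + y ^ CARD('a)"
proof -
  obtain h where h: "CARD('a) = 3 ^ h" using card_power_3 by blast
  have c: "(u + v) ^ 3 = u ^ 3 + v ^ 3" for u v :: 'b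
  proof -
    have "(u + v) ^ 3 = u ^ 3 + v ^ 3 + 3 * (u * u * v + u * v * v)"
      by (simp add: algebra_simps power3_eq_cube)
    then show ?thesis by (simp add: assms)
  qed
  have "(x + y) ^ (3 ^ n) = x ^ (3 ^ n) + y ^ (3 ^ n)" for n
  proof (induction n)
    case (Suc n)
    have p: "z ^ 3 ^ Suc n = (z ^ 3 ^ n) ^ 3" for z :: 'b
      by (simp add: mult.commute flip: power_mult)
    show ?case unfolding p Suc.IH c ..
  qed simp
  then show ?thesis unfolding h .
qed

lemma frobenius_add: "(x + y :: 'a alg_closure) ^ CARD('a) = x ^ CARD('a) + y ^ CARD('a)"
proof (rule add_power_card)
  have "to_ac (3 :: 'a) = 0" by (simp only: three_eq_0 to_ac_0)
  then show "(3 :: 'a alg_closure) = 0" by simp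
qed

lemma frobenius_to_ac: "to_ac x ^ CARD('a) = to_ac (x :: 'a)"
  by (simp add: power_card_field flip: to_ac_power)

text \<open>The fixed points are the roots of X^q - X, at most \<open>q\<close> in number, and the
  embedded ground field already supplies \<open>q\<close> of them.\<close>

lemma frobenius_fixed_iff: "(x :: 'a alg_closure) ^ CARD('a) = x \<longleftrightarrow> x \<in> range to_ac"
proof -
  let ?q = "CARD('a)"
  define f :: "'a alg_closure poly" where "f = Polynomial.monom 1 ?q - Polynomial.monom 1 1"
  have "Polynomial.coeff f ?q = 1" using card_field_ge_3 by (simp add: f_def)
  then have f0: "f \<noteq> 0" by auto
  have deg: "Polynomial.degree f \<le> ?q" unfolding f_def
    using card_field_ge_3 by (intro degree_diff_le) (auto simp: degree_monom_eq)
  have roots: "{x. poly f x = 0} = {x. x ^ ?q = x}" by (simp add: f_def poly_monom)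
  have "card {x. poly f x = 0} \<le> Polynomial.degree f" by (rule card_poly_roots_bound[OF f0])
  then have le: "card {x :: 'a alg_closure. x ^ ?q = x} \<le> card (range (to_ac :: 'a \<Rightarrow> _))"
    using deg by (simp add: roots card_image inj_to_ac)
  have fin: "finite {x :: 'a alg_closure. x ^ ?q = x}"
    using poly_roots_finite[OF f0] by (simp add: roots)
  have "range (to_ac :: 'a \<Rightarrow> _) = {x :: 'a alg_closure. x ^ ?q = x}"
    by (rule card_seteq[OF fin _ le]) (auto simp: frobenius_to_ac)
  then show ?thesis by auto
qed

text \<open>Sum and product of \<open>u\<close> and its conjugate are fixed by Frobenius and
  therefore come from the ground field. Conversely, a root \<open>u\<close> of an irreducible
  quadratic exists in the closure, and its Frobenius image is the other root.\<close>

lemma imaginary_chord_iff: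
  "imaginary_chord l \<longleftrightarrow> l \<in> quad_line ` (irreducible_quadratics :: ('a \<times> 'a) set)"
proof
  assume "imaginary_chord l"
  then obtain u where l: "pg_line l" and u: "u \<in> quadratic_extension" "u \<notin> range to_ac"
    and sp: "vec.span (extend_vec ` l) = vec.span {cubic_vec u, cubic_vec (u ^ CARD('a))}"
    by (auto simp: imaginary_chord_def)
  define v where "v = u ^ CARD('a)"
  have vu: "v ^ CARD('a) = u"
    using u(1) by (simp add: v_def quadratic_extension_def power2_eq_square flip: power_mult)
  have uv: "u \<noteq> v" using u(2) frobenius_fixed_iff[of u] by (auto simp: v_def)
  have "(u + v) ^ CARD('a) = u + v"
    using vu by (simp add: frobenius_add add.commute flip: v_def)
  then obtain s where s: "u + v = to_ac s" unfolding frobenius_fixed_iff by blast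
  have "(u * v) ^ CARD('a) = u * v"
    using vu by (simp add: power_mult_distrib mult.commute flip: v_def)
  then obtain d where d: "u * v = to_ac d" unfolding frobenius_fixed_iff by blast
  have "t ^ 2 - s * t + d \<noteq> 0" for t
  proof
    assume "t ^ 2 - s * t + d = 0"
    then have "to_ac (t ^ 2 - s * t + d) = 0" by simp
    then have "to_ac t ^ 2 - to_ac s * to_ac t + to_ac d = 0" by simp
    then have "(to_ac t - u) * (to_ac t - v) = 0"
      unfolding s[symmetric] d[symmetric] by (simp add: algebra_simps power2_eq_square)
    then have "to_ac t = u \<or> to_ac t = v" by simp
    then have "u = to_ac t" using vu frobenius_to_ac by metis
    with u(2) show False by blast
  qed
  then have irr: "(s, d) \<in> irreducible_quadratics" by (simp add: irreducible_quadratics_def)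
  have e: "vec.span (extend_vec ` l) = quad_line (to_ac s, to_ac d)"
    unfolding sp v_def[symmetric] s[symmetric] d[symmetric] quad_line_eq_chord[OF uv] ..
  have "l \<subseteq> quad_line (s, d)"
  proof
    fix x assume "x \<in> l"
    then have "extend_vec x \<in> vec.span (extend_vec ` l)" by (simp add: vec.span_base)
    then show "x \<in> quad_line (s, d)" unfolding e extend_vec_mem_quad_line .
  qed
  then have "l = quad_line (s, d)" by (rule pg_line_subset_eq[OF l pg_line_quad_line])
  with irr show "l \<in> quad_line ` irreducible_quadratics" by blast
next
  assume "l \<in> quad_line ` (irreducible_quadratics :: ('a \<times> 'a) set)"
  then obtain s d where irr: "(s, d) \<in> irreducible_quadratics" and l: "l = quad_line (s, d)" by auto
  have "\<exists>u. poly [:to_ac d, - to_ac s, 1:] u = 0"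
    by (rule alg_closed_imp_poly_has_root) simp
  then obtain u where u: "u ^ 2 - to_ac s * u + to_ac d = 0"
    by (auto simp: algebra_simps power2_eq_square)
  have u_range: "u \<notin> range to_ac"
  proof
    assume "u \<in> range to_ac"
    then obtain t where "u = to_ac t" by blast
    then have "to_ac (t ^ 2 - s * t + d) = 0" using u by simp
    then show False using irr unfolding irreducible_quadratics_def to_ac_eq_0_iff by blast
  qed
  let ?v = "u ^ CARD('a)"
  have ne: "?v \<noteq> u" using u_range by (simp add: frobenius_fixed_iff)
  have "u ^ 2 + to_ac d = to_ac s * u" using u by (simp add: algebra_simps)
  then have "(u ^ 2 + to_ac d) ^ CARD('a) = (to_ac s * u) ^ CARD('a)" by simp
  then have v: "?v ^ 2 + to_ac d = to_ac s * ?v"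
    by (simp add: frobenius_add frobenius_to_ac power_mult_distrib mult.commute flip: power_mult)
  \<comment> \<open>Subtracting the two quadratic equations splits off the nonzero factor
    \<open>?v - u\<close> and leaves the sum of the roots.\<close>
  have "(?v - u) * (?v + u - to_ac s) = (?v ^ 2 + to_ac d - to_ac s * ?v) - (u ^ 2 - to_ac s * u + to_ac d)"
    by (simp add: algebra_simps power2_eq_square)
  also have "\<dots> = 0" using u v by simp
  finally have "?v + u - to_ac s = 0" using ne by simp
  then have s: "u + ?v = to_ac s" by (simp add: algebra_simps)
  have d: "u * ?v = to_ac d"
  proof -
    have "to_ac d = (u + ?v) * u - u ^ 2" using u unfolding s by (simp add: algebra_simps eq_neg_iff_add_eq_0)
    then show ?thesis by (simp add: algebra_simps power2_eq_square)
  qed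
  have "(u + ?v) ^ CARD('a) = u + ?v" unfolding s by (rule frobenius_to_ac)
  then have "?v ^ CARD('a) = u" by (simp add: frobenius_add add.commute)
  then have "u \<in> quadratic_extension"
    by (simp add: quadratic_extension_def power2_eq_square flip: power_mult)
  moreover have "vec.span (extend_vec ` l) = vec.span {cubic_vec u, cubic_vec ?v}"
    unfolding l span_extend_quad_line s[symmetric] d[symmetric]
    by (rule quad_line_eq_chord) (use ne in simp)
  ultimately show "imaginary_chord l"
    unfolding imaginary_chord_def using u_range pg_line_quad_line l by blast
qed

lemma imaginary_chord_external_skew:
  assumes "imaginary_chord (l :: ('a ^ 4) set)"
  shows "external_line l \<and> skew_to_axis l"
proof -
  obtain s d where irr: "\<And>t. t ^ 2 - s * t + d \<noteq> 0" and l: "l = quad_line (s, d)"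
    using assms by (auto simp: imaginary_chord_iff irreducible_quadratics_def)
  have "nu z \<notin> l" if "z \<in> proj_line" for z
    using that irr[of "fst z"] by (auto simp: proj_line_def l quad_line_def nu_def)
  moreover have "x = 0" if "x \<in> l" "x $ 1 = 0" "x $ 4 = 0" for x
  proof -
    have x: "x $ 2 = s * x $ 3" "s * (s * x $ 3) = d * x $ 3"
      using that by (auto simp: l quad_line_def)
    \<comment> \<open>A nonzero axis vector on the line would force \<open>s ^ 2 = d\<close>; in
      characteristic 3 the quadratic then has the root \<open>- s\<close>.\<close>
    have "((- s) ^ 2 - s * (- s) + d) * x $ 3 = 2 * (s * (s * x $ 3)) + d * x $ 3"
      by (simp add: algebra_simps power2_eq_square)
    also have "\<dots> = 3 * (d * x $ 3)" unfolding x(2) by simp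
    also have "\<dots> = 0" by (simp add: three_eq_0)
    finally have "x $ 3 = 0" using irr[of "- s"] by simp
    then show ?thesis using x that by (simp add: vec4_eq_iff)
  qed
  ultimately show ?thesis
    using pg_line_quad_line[of "(s, d)"] skew_to_axis_iff[of l] l by (auto simp: external_line_iff)
qed

text \<open>The same inclusion--exclusion as for lines, with roots as incidences: prescribing one
  root leaves \<open>s\<close> free, two distinct roots determine the quadratic, and no quadratic
  has three.\<close>

lemma card_irreducible_quadratics:
  "2 * int (card (irreducible_quadratics :: ('a \<times> 'a) set)) = int CARD('a) ^ 2 - int CARD('a)"
proof -
  let ?R = "\<lambda>(sd :: 'a \<times> 'a) t. t ^ 2 - fst sd * t + snd sd = 0"
  have root: "t = u \<or> t + u = fst sd" if "?R sd t" "?R sd u" for sd t u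
  proof -
    have "(t - u) * (t + u - fst sd) = (t ^ 2 - fst sd * t + snd sd) - (u ^ 2 - fst sd * u + snd sd)"
      by (simp add: algebra_simps power2_eq_square)
    with that show ?thesis by simp
  qed
  have "2 * int (card {sd \<in> UNIV. \<forall>t \<in> UNIV. \<not> ?R sd t}) =
      2 * int (card (UNIV :: ('a \<times> 'a) set)) - 2 * int CARD('a) * int CARD('a)
      + int CARD('a) * (int CARD('a) - 1)"
  proof (rule card_not_incident)
    fix t :: 'a
    have "{sd \<in> UNIV. ?R sd t} = range (\<lambda>s. (s, s * t - t ^ 2))"
      by (auto simp: image_iff algebra_simps eq_neg_iff_add_eq_0)
    then show "card {sd \<in> UNIV. ?R sd t} = CARD('a)" by (simp add: card_image inj_on_def)
  next
    fix t u :: 'a assume tu: "t \<noteq> u"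
    have "{sd \<in> UNIV. ?R sd t \<and> ?R sd u} = {(t + u, t * u)}"
    proof (intro equalityI subsetI)
      fix sd assume "sd \<in> {sd \<in> UNIV. ?R sd t \<and> ?R sd u}"
      then have r: "?R sd t" "?R sd u" by auto
      have s: "fst sd = t + u" using root[OF r] tu by simp
      have "snd sd = (t ^ 2 - fst sd * t + snd sd) + t * u" unfolding s
        by (simp add: algebra_simps power2_eq_square)
      then have "snd sd = t * u" using r(1) by simp
      with s show "sd \<in> {(t + u, t * u)}" by (cases sd) simp
    qed (auto simp: algebra_simps power2_eq_square)
    then show "card {sd \<in> UNIV. ?R sd t \<and> ?R sd u} = 1" by simp
  next
    fix sd :: "'a \<times> 'a"
    show "card {t \<in> UNIV. ?R sd t} \<le> 2"
    proof (cases "\<exists>t. ?R sd t")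
      case True
      then obtain t where t: "?R sd t" by blast
      have "{t \<in> UNIV. ?R sd t} \<subseteq> {t, fst sd - t}"
      proof
        fix u assume "u \<in> {t \<in> UNIV. ?R sd t}"
        then have "?R sd u" by simp
        from root[OF this t] show "u \<in> {t, fst sd - t}" by (auto simp: eq_diff_eq)
      qed
      then have "card {t \<in> UNIV. ?R sd t} \<le> card {t, fst sd - t}" by (intro card_mono) auto
      also have "\<dots> \<le> 2" by (simp add: card_insert_if)
      finally show ?thesis .
    qed simp
  qed simp_all
  moreover have "{sd \<in> UNIV. \<forall>t \<in> UNIV. \<not> ?R sd t} = (irreducible_quadratics :: ('a \<times> 'a) set)"
    by (auto simp: irreducible_quadratics_def)
  ultimately show ?thesis by (simp add: power2_eq_square algebra_simps)
qed

text \<open>Doubling clears the denominators of both counts and integers avoid truncated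
  subtraction, so that a polynomial identity in the field order remains.\<close>

lemma card_EnGamma_lines:
  "int (card (EnGamma_lines :: ('a ^ 4) set set)) = int CARD('a) * (int CARD('a) + 1) * (int CARD('a) - 1) ^ 2"
proof -
  let ?X = "{l :: ('a ^ 4) set. external_line l \<and> skew_to_axis l}"
  let ?I = "quad_line ` (irreducible_quadratics :: ('a \<times> 'a) set)"
  have eq: "EnGamma_lines = ?X - ?I" by (auto simp: EnGamma_lines_iff imaginary_chord_iff)
  have sub: "?I \<subseteq> ?X" using imaginary_chord_external_skew by (auto simp: imaginary_chord_iff)
  have "card ?I = card (irreducible_quadratics :: ('a \<times> 'a) set)"
    by (rule card_image) (rule inj_on_subset[OF inj_quad_line], simp)
  moreover have "card (EnGamma_lines :: ('a ^ 4) set set) = card ?X - card ?I"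
    unfolding eq using sub by (intro card_Diff_subset) auto
  moreover have "card ?I \<le> card ?X" using sub by (intro card_mono) auto
  ultimately have "int (card (EnGamma_lines :: ('a ^ 4) set set)) =
      int (card ?X) - int (card (irreducible_quadratics :: ('a \<times> 'a) set))"
    by (simp add: of_nat_diff)
  then have "2 * int (card (EnGamma_lines :: ('a ^ 4) set set)) =
      2 * (int CARD('a) * (int CARD('a) + 1) * (int CARD('a) - 1) ^ 2)"
    using card_skew_external card_irreducible_quadratics
    by (simp add: power2_eq_square power4_eq_xxxx algebra_simps)
  then show ?thesis by simp
qed

text \<open>Containing the chord fixes \<open>c2\<close> and \<open>c3\<close>, and the cubic form
  of the plane factors into the quadratic and a linear form. The quadratic has no root in the ground
  field, so \<open>p\<close> and \<open>m\<close> are two zeros of the linear form, which therefore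
  vanishes along with the equation of the plane.\<close>

lemma imaginary_chord_not_in_double_plane:
  assumes "imaginary_chord l" "(p, m) \<in> flags"
  shows "\<not> l \<subseteq> cubic_plane p p (m :: 'a \<times> 'a)"
proof
  assume sub: "l \<subseteq> cubic_plane p p m"
  obtain s d where irr: "\<And>t. t ^ 2 - s * t + d \<noteq> 0" and l: "l = quad_line (s, d)"
    using assms(1) by (auto simp: imaginary_chord_iff irreducible_quadratics_def)
  have P: "p \<in> proj_line" "m \<in> proj_line" "p \<noteq> m" using assms(2) by (auto simp: flags_def)
  obtain c0 c1 c2 c3 where E: "cubic_plane p p m = plane_of c0 c1 c2 c3"
    unfolding cubic_plane_def by blast
  have "vector [s ^ 2 - d, s, 1, 0] \<in> l" "vector [- (s * d), - d, 0, 1] \<in> l"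
    unfolding l quad_line_eq_span by (simp_all add: vec.span_base)
  then have "vector [s ^ 2 - d, s, 1, 0] \<in> plane_of c0 c1 c2 c3"
    "vector [- (s * d), - d, 0, 1] \<in> plane_of c0 c1 c2 c3"
    using sub unfolding E by blast+
  then have "(c0 * (s ^ 2 - d) + c1 * s) + c2 = 0" "- (c0 * (s * d) + c1 * d) + c3 = 0"
    by (simp_all add: plane_of_def)
  then have c: "c2 = - (c0 * (s ^ 2 - d) + c1 * s)" "c3 = c0 * (s * d) + c1 * d"
    unfolding add_eq_0_iff by simp_all
  have fac: "c0 * nu z $ 1 + c1 * nu z $ 2 + c2 * nu z $ 3 + c3 * nu z $ 4 =
      (fst z ^ 2 - s * fst z * snd z + d * snd z ^ 2) * (c0 * fst z + (c1 + c0 * s) * snd z)" for z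
    unfolding c by (simp add: nu_def algebra_simps power2_eq_square power3_eq_cube)
  have lin: "c0 * fst z + (c1 + c0 * s) * snd z = 0" if z: "z \<in> proj_line" "nu z \<in> cubic_plane p p m" for z
  proof -
    have "fst z ^ 2 - s * fst z * snd z + d * snd z ^ 2 \<noteq> 0"
      using z(1) irr[of "fst z"] by (auto simp: proj_line_def)
    moreover have "(fst z ^ 2 - s * fst z * snd z + d * snd z ^ 2) * (c0 * fst z + (c1 + c0 * s) * snd z) = 0"
      using z(2) unfolding E fac[symmetric] by (simp add: plane_of_def)
    ultimately show ?thesis by simp
  qed
  have "c0 = 0 \<and> c1 + c0 * s = 0"
  proof (rule det_nonzero_imp_zero)
    show "c0 * fst p + (c1 + c0 * s) * snd p = 0" "c0 * fst m + (c1 + c0 * s) * snd m = 0"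
      using P by (auto intro!: lin simp: nu_mem_double_plane)
    show "fst p * snd m - fst m * snd p \<noteq> 0"
      using P cross_eq_0_iff[of p m] by (simp add: cross_def mult.commute)
  qed
  then have "c0 = 0" "c1 = 0" by auto
  then have "cubic_plane p p m = UNIV" unfolding E c by (simp add: plane_of_def)
  moreover have "axis_vec m \<notin> cubic_plane p p m"
    using P by (simp add: axis_vec_mem_double_plane cross_eq_0_iff)
  ultimately show False by simp
qed

section \<open>External lines in a plane and the averages\<close>

text \<open>As \<open>axis_vec p\<close> is the only axis point of the plane, a line in it is skew
  exactly when it misses that point. It then cuts the lines joining \<open>axis_vec p\<close> to
  \<open>nu p\<close> and to \<open>nu m\<close> in one point each; \<open>a\<close> and
  \<open>b\<close> are these two independent positions, and the value 0 is the cubic point.\<close>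

lemma EnGamma_lines_in_double_plane:
  assumes f: "(p, m) \<in> flags"
  shows "{l \<in> EnGamma_lines. l \<subseteq> cubic_plane p p m} =
    (\<lambda>(a, b). vec.span {nu p + a *s axis_vec p, nu m + b *s axis_vec (p :: 'a \<times> 'a)})
      ` ((UNIV - {0}) \<times> (UNIV - {0}))" (is "_ = ?F ` _")
    and "inj_on (\<lambda>(a, b). vec.span {nu p + a *s axis_vec p, nu m + b *s axis_vec (p :: 'a \<times> 'a)})
      ((UNIV - {0}) \<times> (UNIV - {0}))"
proof -
  have P: "p \<in> proj_line" "m \<in> proj_line" "p \<noteq> m" using f by (auto simp: flags_def)
  have det: "fst p ^ 3 * snd m ^ 3 - snd p ^ 3 * fst m ^ 3 \<noteq> 0"
    using P by (simp add: cross_cube cross_eq_0_iff)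
  note i = double_plane_eq_span(1)[OF f] and E = double_plane_eq_span(2)[OF f]
  have comb: "x *s (nu p + a *s axis_vec p) + y *s (nu m + b *s axis_vec p) =
      (x * a + y * b) *s axis_vec p + x *s nu p + y *s nu m" for x y a b
    by (simp add: vec.scale_right_distrib vec.scale_left_distrib)
  have ind: "lin_indep2 (nu p + a *s axis_vec p) (nu m + b *s axis_vec p)" for a b
    unfolding lin_indep2_def comb using i unfolding lin_indep3_def by blast
  show "{l \<in> EnGamma_lines. l \<subseteq> cubic_plane p p m} = ?F ` ((UNIV - {0}) \<times> (UNIV - {0}))"
  proof (intro equalityI subsetI)
    fix l assume "l \<in> {l \<in> EnGamma_lines. l \<subseteq> cubic_plane p p m}"
    then have l: "external_line l" "skew_to_axis l" "l \<subseteq> cubic_plane p p m"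
      by (auto simp: EnGamma_lines_iff)
    have ln: "pg_line l" and ext: "nu p \<notin> l" "nu m \<notin> l"
      using l(1) P by (auto simp: external_line_iff)
    \<comment> \<open>With the outer coordinates of \<open>nu p\<close> prescribed, \<open>u\<close>
      can differ from \<open>nu p\<close> only by a multiple of the axis vector.\<close>
    obtain u where u: "u \<in> l" "u $ 1 = fst p ^ 3" "u $ 4 = snd p ^ 3" using skew_section[OF ln l(2)] .
    obtain v where v: "v \<in> l" "v $ 1 = fst m ^ 3" "v $ 4 = snd m ^ 3" using skew_section[OF ln l(2)] .
    have "u \<in> vec.span {axis_vec p, nu p, nu m}" using u(1) l(3) unfolding E by blast
    then obtain a b c where abc: "u = a *s axis_vec p + b *s nu p + c *s nu m" by (auto simp: mem_span3)
    have "b - 1 = 0 \<and> c = 0"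
    proof (rule det_nonzero_imp_zero)
      show "(b - 1) * fst p ^ 3 + c * fst m ^ 3 = 0" "(b - 1) * snd p ^ 3 + c * snd m ^ 3 = 0"
        using u(2,3) unfolding abc by (simp_all add: axis_vec_def nu_def algebra_simps)
    qed (rule det)
    then have ue: "u = nu p + a *s axis_vec p" using abc by simp
    have "v \<in> vec.span {axis_vec p, nu p, nu m}" using v(1) l(3) unfolding E by blast
    then obtain a' b' c' where abc': "v = a' *s axis_vec p + b' *s nu p + c' *s nu m" by (auto simp: mem_span3)
    have "b' = 0 \<and> c' - 1 = 0"
    proof (rule det_nonzero_imp_zero)
      show "b' * fst p ^ 3 + (c' - 1) * fst m ^ 3 = 0" "b' * snd p ^ 3 + (c' - 1) * snd m ^ 3 = 0"
        using v(2,3) unfolding abc' by (simp_all add: axis_vec_def nu_def algebra_simps)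
    qed (rule det)
    then have ve: "v = nu m + a' *s axis_vec p" using abc' by simp
    have "a \<noteq> 0" "a' \<noteq> 0" using u(1) v(1) ext unfolding ue ve by auto
    moreover have "l = ?F (a, a')"
      using pg_line_eq_span[OF ln u(1) v(1)] ind unfolding ue ve by simp
    ultimately show "l \<in> ?F ` ((UNIV - {0}) \<times> (UNIV - {0}))" by auto
  next
    fix l assume "l \<in> ?F ` ((UNIV - {0}) \<times> (UNIV - {0}))"
    then obtain a b where ab: "a \<noteq> 0" "b \<noteq> 0"
      and l: "l = vec.span {nu p + a *s axis_vec p, nu m + b *s axis_vec p}" by auto
    have ln: "pg_line l" unfolding l by (rule pg_line_span[OF ind])
    have sub: "l \<subseteq> cubic_plane p p m" unfolding l E
      by (intro vec.span_minimal vec.subspace_span) (auto intro: vec.span_add vec.span_scale vec.span_base)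
    have "nu z \<notin> l" if z: "z \<in> proj_line" for z
    proof
      assume zl: "nu z \<in> l"
      then obtain x y where e: "nu z = (x * a + y * b) *s axis_vec p + x *s nu p + y *s nu m"
        unfolding l mem_span2 comb by blast
      have "z = p \<or> z = m" using zl sub nu_mem_double_plane[OF z P(1,2)] by blast
      then show False
      proof
        assume "z = p"
        then have "0 *s axis_vec p + 1 *s nu p + 0 *s nu m = (x * a + y * b) *s axis_vec p + x *s nu p + y *s nu m"
          using e by simp
        from lin_indep3_eqD[OF i this] ab show False by auto
      next
        assume "z = m"
        then have "0 *s axis_vec p + 0 *s nu p + 1 *s nu m = (x * a + y * b) *s axis_vec p + x *s nu p + y *s nu m"
          using e by simp
        from lin_indep3_eqD[OF i this] ab show False by auto
      qed
    qed
    then have "external_line l" using ln by (simp add: external_line_iff)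
    moreover have "skew_to_axis l" unfolding skew_to_axis_iff[OF ln]
    proof (intro ballI impI)
      fix w assume w: "w \<in> l" "w $ 1 = 0 \<and> w $ 4 = 0"
      then obtain x y where e: "w = (x * a + y * b) *s axis_vec p + x *s nu p + y *s nu m"
        unfolding l mem_span2 comb by blast
      have "x = 0 \<and> y = 0"
        by (rule det_nonzero_imp_zero[OF _ _ det]) (use w(2) in \<open>simp_all add: e axis_vec_def nu_def\<close>)
      then show "w = 0" using e by simp
    qed
    moreover have "\<not> imaginary_chord l" using imaginary_chord_not_in_double_plane[OF _ f] sub by blast
    ultimately show "l \<in> {l \<in> EnGamma_lines. l \<subseteq> cubic_plane p p m}"
      using sub by (simp add: EnGamma_lines_iff)
  qed
  show "inj_on ?F ((UNIV - {0}) \<times> (UNIV - {0}))"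
  proof (rule inj_onI)
    fix g g' assume g: "?F g = ?F g'"
    obtain a b a' b' where ab: "g = (a, b)" "g' = (a', b')" by (metis prod.exhaust)
    have e: "vec.span {nu p + a *s axis_vec p, nu m + b *s axis_vec p}
      = vec.span {nu p + a' *s axis_vec p, nu m + b' *s axis_vec p}"
      using g by (simp add: ab)
    have m: "nu p + a *s axis_vec p \<in> vec.span {nu p + a' *s axis_vec p, nu m + b' *s axis_vec p}"
      "nu m + b *s axis_vec p \<in> vec.span {nu p + a' *s axis_vec p, nu m + b' *s axis_vec p}"
      unfolding e[symmetric] by (simp_all add: vec.span_base)
    from m(1) obtain x y where
      "nu p + a *s axis_vec p = (x * a' + y * b') *s axis_vec p + x *s nu p + y *s nu m"
      unfolding mem_span2 comb by blast
    then have "a *s axis_vec p + 1 *s nu p + 0 *s nu m = (x * a' + y * b') *s axis_vec p + x *s nu p + y *s nu m"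
      by (simp add: add.commute)
    from lin_indep3_eqD[OF i this] have a: "a = a'" by auto
    from m(2) obtain x y where
      "nu m + b *s axis_vec p = (x * a' + y * b') *s axis_vec p + x *s nu p + y *s nu m"
      unfolding mem_span2 comb by blast
    then have "b *s axis_vec p + 0 *s nu p + 1 *s nu m = (x * a' + y * b') *s axis_vec p + x *s nu p + y *s nu m"
      by (simp add: add.commute)
    from lin_indep3_eqD[OF i this] have "b = b'" by auto
    with a show "g = g'" by (simp add: ab)
  qed
qed

lemma card_EnGamma_lines_in_plane:
  assumes "E \<in> (two_C_planes :: ('a ^ 4) set set)"
  shows "num_lines_in EnGamma_lines E = (CARD('a) - 1) ^ 2"
proof -
  obtain p m where f: "(p, m) \<in> flags" and E: "E = cubic_plane p p m"
    using assms by (auto simp: two_C_planes_eq)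
  show ?thesis
    unfolding num_lines_in_def E EnGamma_lines_in_double_plane(1)[OF f]
      card_image[OF EnGamma_lines_in_double_plane(2)[OF f]]
    by (simp add: card_cartesian_product card_Diff_singleton power2_eq_square)
qed

end

theorem theorem6p2:
  fixes q :: nat
  assumes "q = CARD('a::{field,finite})"
    and "\<exists>h. q = 3 ^ h"
    and "q \<ge> 5"
  shows "(\<forall>\<pi> \<in> (two_C_planes :: ('a ^ 4) set set). num_lines_in EA_lines \<pi> = q - 1)
    \<and> avg_planes_through two_C_planes (EA_lines :: ('a ^ 4) set set) = real q / (real q + 1)
    \<and> (\<forall>\<pi> \<in> (two_C_planes :: ('a ^ 4) set set). num_lines_in EnGamma_lines \<pi> = (q - 1) ^ 2)
    \<and> avg_planes_through two_C_planes (EnGamma_lines :: ('a ^ 4) set set) = 1"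
proof -
  interpret char3_field "TYPE('a)" by standard (use assms in simp)
  \<comment> \<open>The line counts use subtraction on naturals, which is exact here since
    \<open>q\<close> is positive.\<close>
  have q: "real (q - 1) = real q - 1" using assms(3) by (simp add: of_nat_diff)
  have pos: "real q - 1 \<noteq> 0" "real q + 1 \<noteq> 0" "real q \<noteq> 0" using assms(3) by simp_all
  have planes: "real (card (two_C_planes :: ('a ^ 4) set set)) = (real q + 1) * real q"
    by (simp add: card_two_C_planes assms(1) algebra_simps)
  have EA: "num_lines_in EA_lines E = q - 1" if "E \<in> two_C_planes" for E :: "('a ^ 4) set"
    using card_EA_lines_in_plane[OF that] assms(1) by simp
  have En: "num_lines_in EnGamma_lines E = (q - 1) ^ 2" if "E \<in> two_C_planes" for E :: "('a ^ 4) set"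
    using card_EnGamma_lines_in_plane[OF that] assms(1) by simp
  have "real (card (EA_lines :: ('a ^ 4) set set)) = (real q + 1) ^ 2 * (real q - 1)"
    unfolding card_EA_lines assms(1)[symmetric]
    by (simp only: of_nat_mult of_nat_power of_nat_add of_nat_1 q)
  then have 1: "avg_planes_through two_C_planes (EA_lines :: ('a ^ 4) set set) = real q / (real q + 1)"
    using avg_planes_through_eq[of two_C_planes EA_lines "q - 1", OF EA] planes q pos
    by (simp add: power2_eq_square)
  have "real (card (EnGamma_lines :: ('a ^ 4) set set)) = real_of_int (int (card (EnGamma_lines :: ('a ^ 4) set set)))"
    by simp
  also have "\<dots> = real q * (real q + 1) * (real q - 1) ^ 2"
    unfolding card_EnGamma_lines assms(1)[symmetric] by simp
  finally have 2: "avg_planes_through two_C_planes (EnGamma_lines :: ('a ^ 4) set set) = 1"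
    using avg_planes_through_eq[of two_C_planes EnGamma_lines "(q - 1) ^ 2", OF En] planes q pos
    by simp
  show ?thesis using EA En 1 2 by blast
qed

end
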